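(* Let $d,n\in\mathbb{N}$, $\mathcal{V}=\{1,\ldots,n\}$, and let $(\mathcal{G}(t))_{t\in\mathbb{N}_0}$, $(w_{ij}(t))_{i,j\in\mathcal{V},\,t\in\mathbb{N}_0}$ be a time-varying network with weights satisfying the standing assumptions (A1)–(A4) listed in the context. Let $\mu_1(0),\ldots,\mu_n(0)\in \mathcal{P}_{2,ac}(\mathbb{R}^d)$. Suppose that the measures $\mu_i(t)$ follow the update rule $$\mu_i(t+1)=\operatorname{bar}\big(\{(\mu_j(t),w_{ij}(t))\}_{j\in \mathcal{N}_i(t)}\big),\qquad i\in\mathcal{V},\ t\in\mathbb{N}_0.$$ Then, for all $i,j\in\mathcal{V}$, $$\lim_{t\to\infty}W_2(\mu_i(t),\mu_j(t))=0.$$ Moreover, there exists $\mu^*\in\mathcal{P}_2(\mathbb{R}^d)$ such that $$\lim_{t\to\infty}W_p(\mu_i(t),\mu^* )=0$$ for all $i\in\mathcal{V}$ and all $p\in[1,2)$.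
   Context: $\mathbb{N}$ is the set of positive integers and $\mathbb{N}_0=\mathbb{N}\cup\{0\}$. $\mathcal{P}(\mathbb{R}^d)$ is the set of probability measures on $\mathbb{R}^d$ with the Euclidean distance; for $p\in[1,\infty)$, $\mathcal{P}_p(\mathbb{R}^d)=\{\mu\in\mathcal{P}(\mathbb{R}^d):\int|x|^p\,d\mu<\infty\}$, and $\mathcal{P}_{p,ac}(\mathbb{R}^d)$ is the set of measures in $\mathcal{P}_p(\mathbb{R}^d)$ that are absolutely continuous (with respect to Lebesgue measure). For $\mu,\nu\in\mathcal{P}_p(\mathbb{R}^d)$, the $p$-Wasserstein distance is $W_p(\mu,\nu)=\min_{\gamma\in\Pi(\mu,\nu)}\big(\int|x-y|^p\,d\gamma(x,y)\big)^{1/p}$, where $\Pi(\mu,\nu)$ is the set of probability measures on $\mathbb{R}^d\times\mathbb{R}^d$ with first marginal $\mu$ and second marginal $\nu$. Wasserstein barycenter: for a nonempty finite set $E\subset\mathbb{N}$, measures $\mu_j\in\mathcal{P}_2(\mathbb{R}^d)$ and weights $\lambda_j>0$ ($j\in E$) with $\sum_{j\in E}\lambda_j=1$, $\operatorname{bar}(\{(\mu_j,\lambda_j)\}_{j\in E}):=\operatorname{argmin}_{\nu\in\mathcal{P}_2(\mathbb{R}^d)}\sum_{j\in E}\lambda_jW_2^2(\mu_j,\nu)$. Network and standing assumptions. The agents are indexed by $\mathcal{V}=\{1,\ldots,n\}$. (A1) For each $t\in\mathbb{N}_0$, $\mathcal{G}(t)=(\mathcal{V},\mathcal{E}(t))$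 is an undirected graph, i.e. $\mathcal{E}(t)\subset\mathcal{V}\times\mathcal{V}$ is symmetric, and $(i,i)\in\mathcal{E}(t)$ for all $i\in\mathcal{V}$. The neighbor set of $i$ at time $t$ is $\mathcal{N}_i(t)=\{j\in\mathcal{V}:(i,j)\in\mathcal{E}(t)\}$; thus $i\in\mathcal{N}_i(t)$. (A2) The weights $w_{ij}(t)$ are real numbers with $w_{ij}(t)>0$ if $(i,j)\in\mathcal{E}(t)$, $w_{ij}(t)=0$ otherwise, and $\sum_{j\in\mathcal{N}_i(t)}w_{ij}(t)=1$ for all $i\in\mathcal{V}$, $t\in\mathbb{N}_0$. (A3) There is a constant $\delta\in(0,1)$ such that $w_{ij}(t)\ge\delta$ whenever $j\in\mathcal{N}_i(t)$, for all $i,j\in\mathcal{V}$, $t\in\mathbb{N}_0$. (A4) There are integers $0=\tau_0<\tau_1<\tau_2<\cdots$ (an infinite sequence) with $\sup_i|\tau_i-\tau_{i-1}|=L<\infty$ such that for each $i\in\mathbb{N}_0$ the collection $\{\mathcal{G}(\tau_i),\ldots,\mathcal{G}(\tau_{i+1}-1)\}$ is jointly connected, meaning that the union graph $(\mathcal{V},\bigcup_{t=\tau_i}^{\tau_{i+1}-1}\mathcal{E}(t))$ is connected. *)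

theory Defs
  imports "HOL-Probability.Probability"
begin

definition prob_measures :: "'a::topological_space measure set" where
  "prob_measures = {\<mu>. prob_space \<mu> \<and> sets \<mu> = sets borel}"

definition finite_moment_measures :: "real \<Rightarrow> 'a::euclidean_space measure set" where
  "finite_moment_measures p = {\<mu> \<in> prob_measures. integrable \<mu> (\<lambda>x. norm x powr p)}"

definition ac_finite_moment_measures :: "real \<Rightarrow> 'a::euclidean_space measure set" where
  "ac_finite_moment_measures p =
     {\<mu> \<in> finite_moment_measures p. absolutely_continuous lborel \<mu>}"

definition couplings ::
    "'a::topological_space measure \<Rightarrow> 'a measure \<Rightarrow> ('a \<times> 'a) measure set" where
  "couplings \<mu> \<nu> =
     {\<gamma> \<in> prob_measures. distr \<gamma> borel fst = \<mu> \<and> distr \<gamma> borel snd = \<nu>}"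

(* Intended for p \<ge> 1 and measures in finite_moment_measures p only. There the cost is
   integrable for every coupling, so the Bochner integral takes no junk value, and the
   infimum, taken over a nonempty set of nonnegative reals, is attained. *)
definition wasserstein ::
    "real \<Rightarrow> 'a::euclidean_space measure \<Rightarrow> 'a measure \<Rightarrow> real" where
  "wasserstein p \<mu> \<nu> =
     (INF \<gamma>\<in>couplings \<mu> \<nu>. \<integral>z. norm (fst z - snd z) powr p \<partial>\<gamma>) powr (1 / p)"

(* The argmin is a set: uniqueness of the minimizer is not built into the definition. *)
definition barycenters ::
    "nat set \<Rightarrow> (nat \<Rightarrow> 'a::euclidean_space measure) \<Rightarrow> (nat \<Rightarrow> real) \<Rightarrow> 'a measure set" where
  "barycenters J \<mu> a =
     {\<nu>. is_arg_min (\<lambda>\<nu>. \<Sum>j\<in>J. a j * (wasserstein 2 (\<mu> j) \<nu>)\<^sup>2)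
           (\<lambda>\<nu>. \<nu> \<in> finite_moment_measures 2) \<nu>}"

definition neighbors :: "'v set \<Rightarrow> ('v \<times> 'v) set \<Rightarrow> 'v \<Rightarrow> 'v set" where
  "neighbors V E i = {j \<in> V. (i, j) \<in> E}"

definition connected_graph :: "'v set \<Rightarrow> ('v \<times> 'v) set \<Rightarrow> bool" where
  "connected_graph V E \<longleftrightarrow> (\<forall>i\<in>V. \<forall>j\<in>V. (i, j) \<in> E\<^sup>*)"

end

theory Submission
  imports Defs
begin

text \<open>
  The proof rests on a single property of barycenters: if \<open>\<nu>\<close> is a barycenter of measures
  \<open>\<mu>\<^sub>j\<close> with weights \<open>a\<^sub>j\<close>, then \<open>\<integral>\<psi> d\<nu> \<le> \<Sum>\<^sub>j a\<^sub>j \<integral>\<psi> d\<mu>\<^sub>j\<close> for every convex \<open>\<psi>\<close> with a Borel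
  subgradient selection \<open>\<xi>\<close> of linear growth. It is the first-order optimality condition for the
  barycenter, tested with the perturbation \<open>y \<mapsto> y - s \<xi>(y)\<close> of \<open>\<nu>\<close>
  in nearly optimal couplings (\<open>barycenter_convex_integral_le\<close>).

  Hence, along the network dynamics, the numbers \<open>x\<^sub>i(t) = \<integral>\<psi> d\<mu>\<^sub>i(t)\<close> satisfy
  \<open>x\<^sub>i(t+1) \<le> \<Sum>\<^sub>j w\<^sub>i\<^sub>j(t) x\<^sub>j(t)\<close>. Their maximum over \<open>i\<close> decreases, and on a symmetric, uniformly jointly
  connected network an agent lying below the maximum by a fixed amount drags the maximum down within
  a bounded time. So, for \<open>\<psi> \<ge> 0\<close>, all \<open>x\<^sub>i(t)\<close> converge to one common limit
  (\<open>consensus_of_averaging_inequality\<close>). This is used twice.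

  With \<open>\<psi>(x) = max (|x|\<^sup>2 - R) 0\<close>, the bound by the initial maximum shows that \<open>|x|\<^sup>2\<close> is uniformly
  integrable along all trajectories; such families are relatively compact for the distance \<open>W\<^sub>2\<close>
  (\<open>Wasserstein_compactness\<close>). To get compactness, measures on the Euclidean space are lifted to the
  real line by a Borel right inverse of a continuous space-filling curve. Helly's selection theorem
  and Skorohod's representation theorem apply on the line, and the curve carries the pointwise
  convergent random variables back.

  With \<open>\<psi>\<close> convex, Lipschitz and nonnegative, the common limit shows that all subsequential limits
  of all agents integrate these \<open>\<psi>\<close> identically, and such functions determine a measure
  (\<open>convex_lipschitz_determines_measure\<close>). So there is only one limit point \<open>\<mu>'\<close>, and
  \<open>W\<^sub>2(\<mu>\<^sub>i(t), \<mu>') \<rightarrow> 0\<close> for every agent. The statement for \<open>p < 2\<close> follows from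
  \<open>W\<^sub>p \<le> 2 W\<^sub>2\<close>, and the consensus \<open>W\<^sub>2(\<mu>\<^sub>i(t), \<mu>\<^sub>j(t)) \<rightarrow> 0\<close> from a triangle inequality up to a constant
  factor (\<open>wasserstein_2_quasi_triangle\<close>), for which two couplings are glued approximately, through a
  density that is constant on products of small cells.
\<close>


section \<open>Couplings and the quadratic cost\<close>

definition sq_cost :: "('a::euclidean_space \<times> 'a) measure \<Rightarrow> real" where
  "sq_cost \<gamma> = (\<integral>z. (norm (fst z - snd z))\<^sup>2 \<partial>\<gamma>)"

lemma powr_two: "x \<ge> 0 \<Longrightarrow> x powr 2 = (x::real)\<^sup>2"
  by (metis powr_numeral)

lemma finite_second_moment_iff:
  "\<mu> \<in> finite_moment_measures 2 \<longleftrightarrow>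
     prob_space \<mu> \<and> sets \<mu> = sets borel \<and> integrable \<mu> (\<lambda>x. (norm x)\<^sup>2)"
  by (simp add: finite_moment_measures_def prob_measures_def powr_two)

lemma borel_measurable_borel_sets:
  "sets M = sets (borel :: 'a::topological_space measure) \<Longrightarrow> (f \<in> borel_measurable M) = (f \<in> borel_measurable borel)"
  by (simp cong: measurable_cong_sets)

lemma couplingsD:
  assumes "\<gamma> \<in> couplings \<mu> \<nu>"
  shows "prob_space \<gamma>" "sets \<gamma> = sets borel" "space \<gamma> = UNIV" "distr \<gamma> borel fst = \<mu>" "distr \<gamma> borel snd = \<nu>"
    "prob_space \<mu>" "prob_space \<nu>" "sets \<mu> = sets borel" "sets \<nu> = sets borel"
proof -
  show 1: "prob_space \<gamma>" and 2: "sets \<gamma> = sets borel" and 3: "distr \<gamma> borel fst = \<mu>" and 4: "distr \<gamma> borel snd = \<nu>"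
    using assms by (auto simp: couplings_def prob_measures_def)
  show "space \<gamma> = UNIV" using 2 by (metis sets_eq_imp_space_eq space_borel)
  interpret prob_space \<gamma> by fact
  have "fst \<in> measurable \<gamma> borel" "snd \<in> measurable \<gamma> borel"
    unfolding borel_measurable_borel_sets[OF 2]
    by (intro borel_measurable_continuous_onI continuous_on_fst continuous_on_snd continuous_on_id)+
  then show "prob_space \<mu>" "prob_space \<nu>" "sets \<mu> = sets borel" "sets \<nu> = sets borel"
    using 3 4 prob_space_distr by auto
qed

lemma coupling_measurable:
  fixes f :: "'a::second_countable_topology \<times> 'a \<Rightarrow> 'b::topological_space"
  assumes "\<gamma> \<in> couplings \<mu> \<nu>" "f \<in> borel \<Otimes>\<^sub>M borel \<rightarrow>\<^sub>M borel"
  shows "f \<in> borel_measurable \<gamma>"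
  using assms(2) unfolding borel_prod borel_measurable_borel_sets[OF couplingsD(2)[OF assms(1)]] .

lemma coupling_marginals:
  fixes f :: "'a::second_countable_topology \<Rightarrow> real"
  assumes \<gamma>: "\<gamma> \<in> couplings \<mu> \<nu>" and f: "f \<in> borel_measurable borel"
  shows "(\<integral>z. f (fst z) \<partial>\<gamma>) = (\<integral>x. f x \<partial>\<mu>)" "(\<integral>z. f (snd z) \<partial>\<gamma>) = (\<integral>x. f x \<partial>\<nu>)"
    "integrable \<gamma> (\<lambda>z. f (fst z)) = integrable \<mu> f" "integrable \<gamma> (\<lambda>z. f (snd z)) = integrable \<nu> f"
proof -
  have m: "fst \<in> borel_measurable \<gamma>" "snd \<in> borel_measurable \<gamma>"
    by (auto intro: coupling_measurable[OF \<gamma>])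
  note d = couplingsD(4,5)[OF \<gamma>, symmetric]
  show "(\<integral>z. f (fst z) \<partial>\<gamma>) = (\<integral>x. f x \<partial>\<mu>)" "(\<integral>z. f (snd z) \<partial>\<gamma>) = (\<integral>x. f x \<partial>\<nu>)"
    "integrable \<gamma> (\<lambda>z. f (fst z)) = integrable \<mu> f" "integrable \<gamma> (\<lambda>z. f (snd z)) = integrable \<nu> f"
    unfolding d using m f by (simp_all add: integral_distr integrable_distr_eq)
qed

lemma norm_add_sq_le:
  fixes x y :: "'a::real_inner"
  shows "(norm (x + y))\<^sup>2 \<le> 2 * (norm x)\<^sup>2 + 2 * (norm y)\<^sup>2"
proof -
  have "(norm (x + y))\<^sup>2 + (norm (x - y))\<^sup>2 = 2 * (norm x)\<^sup>2 + 2 * (norm y)\<^sup>2"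
    by (simp add: power2_norm_eq_inner inner_add inner_diff inner_commute)
  then show ?thesis by (smt (verit) zero_le_power2)
qed

lemma norm_diff_sq_le:
  fixes x y :: "'a::real_inner"
  shows "(norm (x - y))\<^sup>2 \<le> 2 * (norm x)\<^sup>2 + 2 * (norm y)\<^sup>2"
  using norm_add_sq_le[of x "-y"] by simp

lemma coupling_sq_integrable:
  fixes \<mu> \<nu> :: "'a::euclidean_space measure"
  assumes \<gamma>: "\<gamma> \<in> couplings \<mu> \<nu>"
    and "\<mu> \<in> finite_moment_measures 2" "\<nu> \<in> finite_moment_measures 2"
  shows "integrable \<gamma> (\<lambda>z. (norm (fst z - snd z))\<^sup>2)"
proof (rule Bochner_Integration.integrable_bound)
  show "integrable \<gamma> (\<lambda>z. 2 * (norm (fst z))\<^sup>2 + 2 * (norm (snd z))\<^sup>2)"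
    using assms coupling_marginals(3)[OF \<gamma>, of "\<lambda>x. (norm x)\<^sup>2"]
     coupling_marginals(4)[OF \<gamma>, of "\<lambda>x. (norm x)\<^sup>2"]
    by (simp add: finite_second_moment_iff)
  show "(\<lambda>z. (norm (fst z - snd z))\<^sup>2) \<in> borel_measurable \<gamma>"
    by (rule coupling_measurable[OF \<gamma>]) measurable
  show "AE z in \<gamma>. norm ((norm (fst z - snd z))\<^sup>2) \<le> norm (2 * (norm (fst z))\<^sup>2 + 2 * (norm (snd z))\<^sup>2)"
    by (auto intro!: AE_I2 simp: norm_diff_sq_le)
qed

text \<open>
  The product measure is what makes every set of couplings, and hence every infimum below, nonempty.
\<close>

lemma pair_measure_coupling:
  fixes \<mu> \<nu> :: "'a::second_countable_topology measure"
  assumes "prob_space \<mu>" "prob_space \<nu>" "sets \<mu> = sets borel" "sets \<nu> = sets borel"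
  shows "\<mu> \<Otimes>\<^sub>M \<nu> \<in> couplings \<mu> \<nu>"
proof -
  interpret \<mu>: prob_space \<mu> by fact
  interpret \<nu>: prob_space \<nu> by fact
  interpret P: pair_prob_space \<mu> \<nu> ..
  have s: "sets (\<mu> \<Otimes>\<^sub>M \<nu>) = sets borel"
    using sets_pair_measure_cong[OF assms(3,4)] unfolding borel_prod .
  have "distr (\<mu> \<Otimes>\<^sub>M \<nu>) borel fst = distr (\<mu> \<Otimes>\<^sub>M \<nu>) \<mu> fst"
    using assms by (intro distr_cong) auto
  also have "\<dots> = \<mu>" by (rule \<nu>.distr_pair_fst)
  finally have 1: "distr (\<mu> \<Otimes>\<^sub>M \<nu>) borel fst = \<mu>" .
  have "distr (\<mu> \<Otimes>\<^sub>M \<nu>) borel snd = distr (distr (\<nu> \<Otimes>\<^sub>M \<mu>) (\<mu> \<Otimes>\<^sub>M \<nu>) (\<lambda>(x, y). (y, x))) \<nu> snd"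
    using assms by (subst P.distr_pair_swap) (auto intro!: distr_cong)
  also have "\<dots> = distr (\<nu> \<Otimes>\<^sub>M \<mu>) \<nu> fst"
    by (subst distr_distr) (auto intro!: distr_cong)
  also have "\<dots> = \<nu>" by (rule \<mu>.distr_pair_fst)
  finally show ?thesis
    using 1 s P.prob_space_axioms by (simp add: couplings_def prob_measures_def)
qed

lemma sq_cost_nonneg: "0 \<le> sq_cost \<gamma>"
  by (simp add: sq_cost_def)

lemma wasserstein_2_sq:
  assumes "\<mu> \<in> finite_moment_measures 2" "\<nu> \<in> finite_moment_measures 2"
  shows "(wasserstein 2 \<mu> \<nu>)\<^sup>2 = (INF \<gamma>\<in>couplings \<mu> \<nu>. sq_cost \<gamma>)"
proof -
  have ne: "couplings \<mu> \<nu> \<noteq> {}"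
    using pair_measure_coupling[of \<mu> \<nu>] assms by (auto simp: finite_second_moment_iff)
  have "(INF \<gamma>\<in>couplings \<mu> \<nu>. sq_cost \<gamma>) \<ge> 0"
    using ne by (intro cINF_greatest) (auto simp: sq_cost_nonneg)
  then have "((INF \<gamma>\<in>couplings \<mu> \<nu>. sq_cost \<gamma>) powr (1/2))\<^sup>2 = (INF \<gamma>\<in>couplings \<mu> \<nu>. sq_cost \<gamma>)"
    by (simp add: powr_half_sqrt)
  then show ?thesis
    by (simp add: wasserstein_def sq_cost_def powr_two)
qed

lemma bdd_below_sq_cost: "bdd_below (sq_cost ` S)"
  by (auto intro!: bdd_belowI[where m=0] simp: sq_cost_nonneg)

lemma wasserstein_2_sq_le:
  assumes "\<mu> \<in> finite_moment_measures 2" "\<nu> \<in> finite_moment_measures 2" "\<gamma> \<in> couplings \<mu> \<nu>"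
  shows "(wasserstein 2 \<mu> \<nu>)\<^sup>2 \<le> sq_cost \<gamma>"
  unfolding wasserstein_2_sq[OF assms(1,2)] using assms(3) bdd_below_sq_cost by (rule cINF_lower[rotated])

lemma wasserstein_2_sq_approx:
  assumes "\<mu> \<in> finite_moment_measures 2" "\<nu> \<in> finite_moment_measures 2" "e > 0"
  obtains \<gamma> where "\<gamma> \<in> couplings \<mu> \<nu>" "sq_cost \<gamma> < (wasserstein 2 \<mu> \<nu>)\<^sup>2 + e"
proof -
  have ne: "couplings \<mu> \<nu> \<noteq> {}"
    using pair_measure_coupling[of \<mu> \<nu>] assms by (auto simp: finite_second_moment_iff)
  have "(INF \<gamma>\<in>couplings \<mu> \<nu>. sq_cost \<gamma>) < (wasserstein 2 \<mu> \<nu>)\<^sup>2 + e"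
    using wasserstein_2_sq[OF assms(1,2)] assms(3) by simp
  then show thesis
    using that cINF_less_iff[OF ne bdd_below_sq_cost] by blast
qed

lemma wasserstein_nonneg: "0 \<le> wasserstein p \<mu> \<nu>"
  by (simp add: wasserstein_def)

section \<open>Convex functions under barycenters\<close>

text \<open>
  A convex function together with a Borel selection \<open>\<xi>\<close> of its subgradients. The linear growth of \<open>\<xi>\<close>
  keeps \<open>y - s \<xi>(y)\<close> square integrable, so that measures with finite second moment may be
  perturbed in the direction \<open>\<xi>\<close>.
\<close>

definition has_subgradient :: "('a::euclidean_space \<Rightarrow> real) \<Rightarrow> ('a \<Rightarrow> 'a) \<Rightarrow> real \<Rightarrow> bool" where
  "has_subgradient \<psi> \<xi> K \<longleftrightarrow> \<psi> \<in> borel_measurable borel \<and> \<xi> \<in> borel_measurable borel \<and>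
     (\<forall>x. norm (\<xi> x) \<le> K * (1 + norm x)) \<and> (\<forall>x y. \<psi> y + \<xi> y \<bullet> (x - y) \<le> \<psi> x)"

text \<open>
  Comparing the subgradient inequalities at \<open>0\<close> and at \<open>x\<close> bounds a convex function from both sides.
\<close>

lemma has_subgradient_growth:
  assumes "has_subgradient \<psi> \<xi> K"
  shows "\<bar>\<psi> x\<bar> \<le> (\<bar>\<psi> 0\<bar> + K) + 2 * K * (norm x)\<^sup>2" "0 \<le> K"
proof -
  have b: "norm (\<xi> x) \<le> K * (1 + norm x)" and s: "\<psi> y + \<xi> y \<bullet> (x - y) \<le> \<psi> x" for x y
    using assms by (auto simp: has_subgradient_def)
  show K: "0 \<le> K" using order_trans[OF norm_ge_zero b[of 0]] by simp
  have "\<bar>\<xi> 0 \<bullet> x\<bar> \<le> norm (\<xi> 0) * norm x" by (rule Cauchy_Schwarz_ineq2)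
  also have "\<dots> \<le> K * norm x" using b[of 0] by (intro mult_right_mono) auto
  finally have 1: "\<bar>\<xi> 0 \<bullet> x\<bar> \<le> K * norm x" .
  have "\<bar>\<xi> x \<bullet> x\<bar> \<le> norm (\<xi> x) * norm x" by (rule Cauchy_Schwarz_ineq2)
  also have "\<dots> \<le> K * (1 + norm x) * norm x" using b[of x] by (intro mult_right_mono) auto
  finally have 2: "\<bar>\<xi> x \<bullet> x\<bar> \<le> K * (norm x + (norm x)\<^sup>2)"
    by (simp add: algebra_simps power2_eq_square)
  have 3: "\<psi> 0 + \<xi> 0 \<bullet> x \<le> \<psi> x" "\<psi> x - \<xi> x \<bullet> x \<le> \<psi> 0"
    using s[of 0 x] s[of x 0] by auto
  have "2 * norm x \<le> 1 + (norm x)\<^sup>2"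
    using zero_le_power2[of "norm x - 1"] by (simp add: power2_diff)
  then have "norm x \<le> 1 + (norm x)\<^sup>2" using norm_ge_zero[of x] by linarith
  then have "K * norm x \<le> K * (1 + (norm x)\<^sup>2)" using K by (rule mult_left_mono)
  then have "K * norm x \<le> K + K * (norm x)\<^sup>2"
     by (simp add: algebra_simps)
  moreover have "0 \<le> K * (norm x)\<^sup>2" using K by simp
  ultimately show "\<bar>\<psi> x\<bar> \<le> (\<bar>\<psi> 0\<bar> + K) + 2 * K * (norm x)\<^sup>2"
    using 1 2 3 by (simp add: algebra_simps)
qed

lemma quadratic_growth_integrable:
  fixes f :: "'a::euclidean_space \<Rightarrow> real"
  assumes "\<mu> \<in> finite_moment_measures 2" "f \<in> borel_measurable borel" "\<And>x. \<bar>f x\<bar> \<le> a + b * (norm x)\<^sup>2"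
  shows "integrable \<mu> f"
proof -
  interpret prob_space \<mu> using assms(1) by (simp add: finite_second_moment_iff)
  have s: "sets \<mu> = sets borel" using assms(1) by (simp add: finite_second_moment_iff)
  show ?thesis
  proof (rule Bochner_Integration.integrable_bound)
    show "integrable \<mu> (\<lambda>x. a + b * (norm x)\<^sup>2)"
      using assms(1) by (simp add: finite_second_moment_iff)
    show "f \<in> borel_measurable \<mu>" using assms(2) by (simp add: borel_measurable_borel_sets[OF s])
    show "AE x in \<mu>. norm (f x) \<le> norm (a + b * (norm x)\<^sup>2)"
      using assms(3) by (intro AE_I2) (smt (verit) real_norm_def)
  qed
qed

lemma has_subgradient_integrable:
  assumes "has_subgradient \<psi> \<xi> K" "\<mu> \<in> finite_moment_measures 2"
  shows "integrable \<mu> \<psi>"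
  using assms(2) _ has_subgradient_growth(1)[OF assms(1)]
  by (rule quadratic_growth_integrable) (use assms(1) in \<open>simp add: has_subgradient_def\<close>)

lemma coupling_map_snd:
  fixes T :: "'a::second_countable_topology \<Rightarrow> 'a"
  assumes \<gamma>: "\<gamma> \<in> couplings \<mu> \<nu>" and T[measurable]: "T \<in> borel_measurable borel"
  shows "distr \<gamma> borel (\<lambda>z. (fst z, T (snd z))) \<in> couplings \<mu> (distr \<nu> borel T)"
proof -
  note d = couplingsD[OF \<gamma>]
  interpret prob_space \<gamma> by (rule d)
  have m: "(\<lambda>z. (fst z, T (snd z))) \<in> borel_measurable \<gamma>"
    by (rule coupling_measurable[OF \<gamma>]) measurable
  have m2: "snd \<in> borel_measurable \<gamma>" by (rule coupling_measurable[OF \<gamma>]) measurable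
  have f: "fst \<in> borel_measurable (borel :: ('a \<times> 'a) measure)" "snd \<in> borel_measurable (borel :: ('a \<times> 'a) measure)"
    by (intro borel_measurable_continuous_onI continuous_on_fst continuous_on_snd continuous_on_id)+
  have "distr (distr \<gamma> borel (\<lambda>z. (fst z, T (snd z)))) borel fst = \<mu>"
    by (subst distr_distr[OF f(1) m]) (simp add: o_def d(4))
  moreover have "distr (distr \<gamma> borel (\<lambda>z. (fst z, T (snd z)))) borel snd = distr \<nu> borel T"
    unfolding d(5)[symmetric]
    by (subst distr_distr[OF f(2) m], subst distr_distr[OF T m2]) (simp add: o_def)
  ultimately show ?thesis
    using prob_space_distr[OF m] by (simp add: couplings_def prob_measures_def)
qed

lemma coupling_map_snd_cost:
  fixes T :: "'a::euclidean_space \<Rightarrow> 'a"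
  assumes \<gamma>: "\<gamma> \<in> couplings \<mu> \<nu>" and T[measurable]: "T \<in> borel_measurable borel"
  shows "sq_cost (distr \<gamma> borel (\<lambda>z. (fst z, T (snd z)))) = (\<integral>z. (norm (fst z - T (snd z)))\<^sup>2 \<partial>\<gamma>)"
proof -
  have m: "(\<lambda>z. (fst z, T (snd z))) \<in> borel_measurable \<gamma>"
    by (rule coupling_measurable[OF \<gamma>]) measurable
  have "(\<lambda>z::'a\<times>'a. (norm (fst z - snd z))\<^sup>2) \<in> borel_measurable borel"
    by (intro borel_measurable_continuous_onI continuous_intros)
  then show ?thesis
    unfolding sq_cost_def by (subst integral_distr[OF m]) auto
qed

text \<open>
  Let \<open>(X\<^sub>j, Y)\<close> be couplings of \<open>(\<mu>\<^sub>j, \<nu>)\<close> that are optimal up to \<open>e\<^sup>2\<close>. Replacing \<open>Y\<close> by \<open>Y - e \<xi>(Y)\<close>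
  raises the weighted cost above that of \<open>\<nu>\<close> by at most \<open>e\<^sup>2 + 2 e G + e\<^sup>2 C\<close>, where
  \<open>G = \<Sum>\<^sub>j a\<^sub>j E[\<xi>(Y) \<bullet> (X\<^sub>j - Y)]\<close> and \<open>C = E|\<xi>(Y)|\<^sup>2\<close>. Minimality of \<open>\<nu>\<close> forces this to be
  nonnegative, that is \<open>G \<ge> - e (1 + C) / 2\<close>. Integrating the subgradient inequality
  \<open>\<psi>(Y) + \<xi>(Y) \<bullet> (X\<^sub>j - Y) \<le> \<psi>(X\<^sub>j)\<close> and letting \<open>e\<close> tend to \<open>0\<close> gives the claim.
\<close>

lemma barycenter_convex_integral_le:
  fixes \<mu> :: "nat \<Rightarrow> 'a::euclidean_space measure"
  assumes \<psi>: "has_subgradient \<psi> \<xi> K"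
    and J: "finite J" and a: "\<And>j. j \<in> J \<Longrightarrow> 0 \<le> a j" "(\<Sum>j\<in>J. a j) = 1"
    and \<mu>: "\<And>j. j \<in> J \<Longrightarrow> \<mu> j \<in> finite_moment_measures 2"
    and \<nu>: "\<nu> \<in> barycenters J \<mu> a"
  shows "(\<integral>x. \<psi> x \<partial>\<nu>) \<le> (\<Sum>j\<in>J. a j * (\<integral>x. \<psi> x \<partial>\<mu> j))"
proof -
  have \<nu>2: "\<nu> \<in> finite_moment_measures 2" using \<nu> by (simp add: barycenters_def is_arg_min_def)
  have ps[measurable]: "\<psi> \<in> borel_measurable borel" and xi[measurable]: "\<xi> \<in> borel_measurable borel"
    and b: "norm (\<xi> x) \<le> K * (1 + norm x)" and sub: "\<psi> y + \<xi> y \<bullet> (x - y) \<le> \<psi> x" for x y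
    using \<psi> by (auto simp: has_subgradient_def)
  have K: "0 \<le> K" by (rule has_subgradient_growth(2)[OF \<psi>])
  have xi_growth: "(norm (\<xi> x))\<^sup>2 \<le> 2 * K\<^sup>2 + 2 * K\<^sup>2 * (norm x)\<^sup>2" for x
  proof -
    have "(norm (\<xi> x))\<^sup>2 \<le> (K * (1 + norm x))\<^sup>2" using b by (intro power_mono) auto
    also have "\<dots> = K\<^sup>2 * (1 + norm x)\<^sup>2" by (simp add: power_mult_distrib)
    also have "\<dots> \<le> K\<^sup>2 * (2 + 2 * (norm x)\<^sup>2)"
      using zero_le_power2[of "norm x - 1"] by (intro mult_left_mono) (auto simp: power2_sum power2_diff)
    finally show ?thesis by (simp add: algebra_simps)
  qed
  have int_xi: "integrable \<nu> (\<lambda>x. (norm (\<xi> x))\<^sup>2)"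
    by (rule quadratic_growth_integrable[OF \<nu>2, where a="2 * K\<^sup>2" and b="2 * K\<^sup>2"]) (auto simp: xi_growth)
  define C where "C = (\<integral>x. (norm (\<xi> x))\<^sup>2 \<partial>\<nu>)"
  have "(\<integral>x. \<psi> x \<partial>\<nu>) \<le> (\<Sum>j\<in>J. a j * (\<integral>x. \<psi> x \<partial>\<mu> j)) + e * (1 + C) / 2" if e: "e > 0" for e
  proof -
    have "\<forall>j\<in>J. \<exists>\<gamma>. \<gamma> \<in> couplings (\<mu> j) \<nu> \<and> sq_cost \<gamma> < (wasserstein 2 (\<mu> j) \<nu>)\<^sup>2 + e\<^sup>2"
      using wasserstein_2_sq_approx[OF \<mu> \<nu>2, of _ "e\<^sup>2"] e by (metis zero_less_power)
    then obtain \<gamma> where \<gamma>: "\<And>j. j \<in> J \<Longrightarrow> \<gamma> j \<in> couplings (\<mu> j) \<nu>"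
      and near: "\<And>j. j \<in> J \<Longrightarrow> sq_cost (\<gamma> j) < (wasserstein 2 (\<mu> j) \<nu>)\<^sup>2 + e\<^sup>2"
      by metis
    \<comment> \<open>the perturbation has the same size as the square root of the error in the cost\<close>
    define T where "T y = y - e *\<^sub>R \<xi> y" for y
    have T[measurable]: "T \<in> borel_measurable borel" unfolding T_def by measurable
    have s\<nu>: "sets \<nu> = sets borel" using \<nu>2 by (simp add: finite_second_moment_iff)
    have T\<nu>: "T \<in> borel_measurable \<nu>" by (simp add: borel_measurable_borel_sets[OF s\<nu>])
    have \<nu>T: "distr \<nu> borel T \<in> finite_moment_measures 2"
    proof -
      interpret prob_space \<nu> using \<nu>2 by (simp add: finite_second_moment_iff)
      have "integrable \<nu> (\<lambda>x. (norm (T x))\<^sup>2)"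
      proof (rule quadratic_growth_integrable[OF \<nu>2])
        fix x
        show "\<bar>(norm (T x))\<^sup>2\<bar> \<le> 2 * e\<^sup>2 * (2 * K\<^sup>2) + (2 + 2 * e\<^sup>2 * (2 * K\<^sup>2)) * (norm x)\<^sup>2"
        proof -
          have "2 * e\<^sup>2 * (norm (\<xi> x))\<^sup>2 \<le> 2 * e\<^sup>2 * (2 * K\<^sup>2 + 2 * K\<^sup>2 * (norm x)\<^sup>2)"
            using xi_growth[of x] by (intro mult_left_mono) auto
          then show ?thesis
            using norm_diff_sq_le[of x "e *\<^sub>R \<xi> x"]
            by (simp add: T_def power_mult_distrib algebra_simps)
        qed
      qed measurable
      then show ?thesis
        using prob_space_distr[OF T\<nu>] T\<nu> by (simp add: finite_second_moment_iff integrable_distr_eq)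
    qed
    define G where "G j = (\<integral>z. \<xi> (snd z) \<bullet> (fst z - snd z) \<partial>\<gamma> j)" for j
    have intG: "integrable (\<gamma> j) (\<lambda>z. \<xi> (snd z) \<bullet> (fst z - snd z))" if j: "j \<in> J" for j
    proof (rule Bochner_Integration.integrable_bound)
      show "integrable (\<gamma> j) (\<lambda>z. (norm (\<xi> (snd z)))\<^sup>2 + (norm (fst z - snd z))\<^sup>2)"
        using coupling_sq_integrable[OF \<gamma>[OF j] \<mu>[OF j] \<nu>2] int_xi
          coupling_marginals(4)[OF \<gamma>[OF j], of "\<lambda>x. (norm (\<xi> x))\<^sup>2"] by simp
      show "(\<lambda>z. \<xi> (snd z) \<bullet> (fst z - snd z)) \<in> borel_measurable (\<gamma> j)"
        by (rule coupling_measurable[OF \<gamma>[OF j]]) measurable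
      have "norm (x \<bullet> y) \<le> norm ((norm x)\<^sup>2 + (norm y)\<^sup>2)" for x y :: 'a
      proof -
        have "\<bar>x \<bullet> y\<bar> \<le> norm x * norm y" by (rule Cauchy_Schwarz_ineq2)
        moreover have "2 * (norm x * norm y) \<le> (norm x)\<^sup>2 + (norm y)\<^sup>2"
          using zero_le_power2[of "norm x - norm y"] by (simp add: power2_diff)
        moreover have "0 \<le> norm x * norm y" by simp
        ultimately show ?thesis by simp
      qed
      then show "AE z in \<gamma> j. norm (\<xi> (snd z) \<bullet> (fst z - snd z))
         \<le> norm ((norm (\<xi> (snd z)))\<^sup>2 + (norm (fst z - snd z))\<^sup>2)"
        by (intro AE_I2)
    qed
    have cost: "(wasserstein 2 (\<mu> j) (distr \<nu> borel T))\<^sup>2 \<le> (wasserstein 2 (\<mu> j) \<nu>)\<^sup>2 + e\<^sup>2 + 2 * e * G j + e\<^sup>2 * C"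
      if j: "j \<in> J" for j
    proof -
      have "(wasserstein 2 (\<mu> j) (distr \<nu> borel T))\<^sup>2 \<le> (\<integral>z. (norm (fst z - T (snd z)))\<^sup>2 \<partial>\<gamma> j)"
        using wasserstein_2_sq_le[OF \<mu>[OF j] \<nu>T coupling_map_snd[OF \<gamma>[OF j] T]]
        unfolding coupling_map_snd_cost[OF \<gamma>[OF j] T] .
      also have "(\<lambda>z. (norm (fst z - T (snd z)))\<^sup>2) = (\<lambda>z. (norm (fst z - snd z))\<^sup>2
         + 2 * e * (\<xi> (snd z) \<bullet> (fst z - snd z)) + e\<^sup>2 * (norm (\<xi> (snd z)))\<^sup>2)"
        unfolding T_def power2_norm_eq_inner
        by (rule ext) (simp add: inner_add inner_diff inner_commute power2_eq_square algebra_simps)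
      also have "(\<integral>z. (norm (fst z - snd z))\<^sup>2
         + 2 * e * (\<xi> (snd z) \<bullet> (fst z - snd z)) + e\<^sup>2 * (norm (\<xi> (snd z)))\<^sup>2 \<partial>\<gamma> j)
         = sq_cost (\<gamma> j) + 2 * e * G j + e\<^sup>2 * C"
        using coupling_sq_integrable[OF \<gamma>[OF j] \<mu>[OF j] \<nu>2] intG[OF j] int_xi
          coupling_marginals(2,4)[OF \<gamma>[OF j], of "\<lambda>x. (norm (\<xi> x))\<^sup>2"]
        by (simp add: sq_cost_def G_def C_def)
      finally show ?thesis using near[OF j] by simp
    qed
    have "(\<Sum>j\<in>J. a j * (wasserstein 2 (\<mu> j) \<nu>)\<^sup>2) \<le> (\<Sum>j\<in>J. a j * (wasserstein 2 (\<mu> j) (distr \<nu> borel T))\<^sup>2)"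
      using \<nu> \<nu>T by (auto simp: barycenters_def is_arg_min_def not_less)
    also have "\<dots> \<le> (\<Sum>j\<in>J. a j * ((wasserstein 2 (\<mu> j) \<nu>)\<^sup>2 + e\<^sup>2 + 2 * e * G j + e\<^sup>2 * C))"
      using cost a(1) by (intro sum_mono mult_left_mono) auto
    also have "\<dots> = (\<Sum>j\<in>J. a j * (wasserstein 2 (\<mu> j) \<nu>)\<^sup>2) + (\<Sum>j\<in>J. a j) * (e\<^sup>2 + e\<^sup>2 * C) + 2 * e * (\<Sum>j\<in>J. a j * G j)"
      by (simp add: algebra_simps sum.distrib sum_distrib_left sum_distrib_right)
    finally have "0 \<le> e * (e * (1 + C) + 2 * (\<Sum>j\<in>J. a j * G j))"
      unfolding a(2) by (simp add: algebra_simps power2_eq_square)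
    then have G: "0 \<le> e * (1 + C) + 2 * (\<Sum>j\<in>J. a j * G j)"
      using e by (simp add: zero_le_mult_iff)
    have "(\<integral>x. \<psi> x \<partial>\<nu>) + G j \<le> (\<integral>x. \<psi> x \<partial>\<mu> j)" if j: "j \<in> J" for j
    proof -
      note i = coupling_marginals[OF \<gamma>[OF j] ps] has_subgradient_integrable[OF \<psi> \<nu>2] has_subgradient_integrable[OF \<psi> \<mu>[OF j]]
      have "(\<integral>x. \<psi> x \<partial>\<nu>) + G j = (\<integral>z. \<psi> (snd z) + \<xi> (snd z) \<bullet> (fst z - snd z) \<partial>\<gamma> j)"
        using i intG[OF j] by (simp add: G_def)
      also have "\<dots> \<le> (\<integral>z. \<psi> (fst z) \<partial>\<gamma> j)"
        using i intG[OF j] sub by (intro integral_mono) auto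
      finally show ?thesis using i by simp
    qed
    then have "(\<Sum>j\<in>J. a j * ((\<integral>x. \<psi> x \<partial>\<nu>) + G j)) \<le> (\<Sum>j\<in>J. a j * (\<integral>x. \<psi> x \<partial>\<mu> j))"
      using a(1) by (intro sum_mono mult_left_mono) auto
    also have "(\<Sum>j\<in>J. a j * ((\<integral>x. \<psi> x \<partial>\<nu>) + G j)) = (\<Sum>j\<in>J. a j) * (\<integral>x. \<psi> x \<partial>\<nu>) + (\<Sum>j\<in>J. a j * G j)"
      by (simp add: algebra_simps sum.distrib sum_distrib_left sum_distrib_right)
    finally show ?thesis using G a(2) by simp
  qed
  note * = this
  have C0: "0 \<le> C" unfolding C_def by simp
  show ?thesis
  proof (rule field_le_epsilon)
    fix e :: real assume "e > 0"
    moreover have "2 * e / (1 + C) * (1 + C) / 2 = e" using C0 by (simp add: field_simps)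
    ultimately show "(\<integral>x. \<psi> x \<partial>\<nu>) \<le> (\<Sum>j\<in>J. a j * (\<integral>x. \<psi> x \<partial>\<mu> j)) + e"
      using *[of "2 * e / (1 + C)"] C0 by simp
  qed
qed

section \<open>Averaging inequalities on a jointly connected network\<close>

lemma crossing_edge:
  assumes conn: "connected_graph V E" and S: "S \<subseteq> V" "i \<in> S" "v \<in> V" "v \<notin> S" and E: "E \<subseteq> V \<times> V"
  obtains x y where "(x, y) \<in> E" "x \<in> S" "y \<notin> S"
proof -
  have "(i, v) \<in> E\<^sup>*" using assms by (auto simp: connected_graph_def)
  moreover have "v \<in> S" if "(i, v) \<in> E\<^sup>*" and no: "\<And>x y. (x, y) \<in> E \<Longrightarrow> x \<in> S \<Longrightarrow> y \<in> S"
    using that(1) S(2) by (induction rule: rtrancl_induct) (auto dest: no)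
  ultimately show thesis using that S(4) by blast
qed

text \<open>
  The maximum \<open>m\<close> of the values is decreasing. If agent \<open>i\<close> has the deficit \<open>e\<close> below the maximum at
  time \<open>t\<close>, then the set of agents whose deficit at time \<open>t + s\<close> is still at least \<open>\<delta>\<^sup>s e\<close> never
  shrinks, because of the self-loops, and it gains an agent over every time window whose union graph is
  connected. After a number \<open>N\<close> of steps that depends neither on \<open>i\<close> nor on \<open>t\<close>, it contains every
  agent, so the maximum has dropped by \<open>\<delta>\<^sup>N e\<close>. Since \<open>m\<close> converges, the deficits tend to \<open>0\<close>.
\<close>

lemma consensus_of_averaging_inequality:
  fixes V :: "nat set" and E :: "nat \<Rightarrow> (nat \<times> nat) set" and w :: "nat \<Rightarrow> nat \<Rightarrow> nat \<Rightarrow> real"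
    and x :: "nat \<Rightarrow> nat \<Rightarrow> real" and \<tau> :: "nat \<Rightarrow> nat"
  assumes V: "finite V" "V \<noteq> {}"
    and A1_edges: "\<And>t. E t \<subseteq> V \<times> V"
    and A1_sym: "\<And>t. sym (E t)"
    and A1_loops: "\<And>t i. i \<in> V \<Longrightarrow> (i, i) \<in> E t"
    and A2_sum: "\<And>t i. i \<in> V \<Longrightarrow> (\<Sum>j\<in>neighbors V (E t) i. w i j t) = 1"
    and \<delta>: "0 < \<delta>" "\<delta> < 1"
    and A3_lower: "\<And>t i j. i \<in> V \<Longrightarrow> j \<in> neighbors V (E t) i \<Longrightarrow> w i j t \<ge> \<delta>"
    and A4_mono: "strict_mono \<tau>"
    and A4_gaps: "bdd_above (range (\<lambda>k. \<tau> (Suc k) - \<tau> k))"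
    and A4_connected: "\<And>k. connected_graph V (\<Union>t\<in>{\<tau> k..<\<tau> (Suc k)}. E t)"
    and x0: "\<And>i t. i \<in> V \<Longrightarrow> 0 \<le> x i t"
    and step: "\<And>i t. i \<in> V \<Longrightarrow> x i (Suc t) \<le> (\<Sum>j\<in>neighbors V (E t) i. w i j t * x j t)"
  shows "\<exists>l. \<forall>i\<in>V. x i \<longlonglongrightarrow> l" and "\<forall>i\<in>V. x i t \<le> Max ((\<lambda>i. x i 0) ` V)"
proof -
  define m where "m t = Max ((\<lambda>i. x i t) ` V)" for t
  have x_le: "x i t \<le> m t" if "i \<in> V" for i t using V that by (simp add: m_def)
  have m_le: "m t \<le> c" if "\<And>i. i \<in> V \<Longrightarrow> x i t \<le> c" for t c using V that by (simp add: m_def)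
  have fin: "finite (neighbors V (E t) i)" for t i using V by (simp add: neighbors_def)
  have nb: "j \<in> V" if "j \<in> neighbors V (E t) i" for i j t using that by (simp add: neighbors_def)
  \<comment> \<open>the deficit below a common upper bound is passed on to each neighbour up to a factor\<close>
  have deficit: "\<delta> * (M - x j t) \<le> M - x i (Suc t)"
    if i: "i \<in> V" and j: "j \<in> neighbors V (E t) i" and M: "m t \<le> M" for i j t M
  proof -
    have pos: "0 \<le> M - x k t" if "k \<in> V" for k using x_le[OF that, of t] M by simp
    have wpos: "0 \<le> w i k t" if "k \<in> neighbors V (E t) i" for k
      using A3_lower[OF i that] \<delta> by simp
    have "\<delta> * (M - x j t) \<le> w i j t * (M - x j t)"
      using A3_lower[OF i j] pos[OF nb[OF j]] by (rule mult_right_mono)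
    also have "\<dots> \<le> (\<Sum>k\<in>neighbors V (E t) i. w i k t * (M - x k t))"
      using fin j wpos pos nb by (intro member_le_sum) auto
    also have "\<dots> = (\<Sum>k\<in>neighbors V (E t) i. w i k t) * M - (\<Sum>k\<in>neighbors V (E t) i. w i k t * x k t)"
      by (simp add: algebra_simps sum_subtractf sum_distrib_left)
    also have "\<dots> \<le> M - x i (Suc t)" using A2_sum[OF i] step[OF i] by simp
    finally show ?thesis .
  qed
  have self: "i \<in> neighbors V (E t) i" if "i \<in> V" for i t using that A1_loops by (simp add: neighbors_def)
  have m_Suc: "m (Suc t) \<le> m t" for t
  proof (rule m_le)
    fix i assume i: "i \<in> V"
    have "0 \<le> \<delta> * (m t - x i t)" using x_le[OF i, of t] \<delta> by simp
    then show "x i (Suc t) \<le> m t" using deficit[OF i self[OF i] order_refl, of t] by simp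
  qed
  then have m_anti: "decseq m" by (rule decseq_SucI)
  obtain i0 where i0: "i0 \<in> V" using V by auto
  have m_nonneg: "0 \<le> m t" for t using x0[OF i0, of t] x_le[OF i0, of t] by simp
  show "\<forall>i\<in>V. x i t \<le> Max ((\<lambda>i. x i 0) ` V)"
    using x_le[of _ t] decseqD[OF m_anti, of 0 t] by (force simp: m_def)
  obtain l where l: "m \<longlonglongrightarrow> l" using decseq_convergent[OF m_anti, of 0] m_nonneg by metis
  obtain B where B: "\<And>k. \<tau> (Suc k) - \<tau> k \<le> B" using A4_gaps by (auto simp: bdd_above_def)
  \<comment> \<open>the wait for the next window to begin, then one window for each agent still to be reached\<close>
  define N where "N = \<tau> 0 + Suc (card V) * B"
  have main: "\<delta> ^ N * (m t - x i t) \<le> m t - m (t + N)" if i: "i \<in> V" for i t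
  proof -
    define e where "e = m t - x i t"
    define S where "S s = {j \<in> V. \<delta> ^ s * e \<le> m t - x j (t + s)}" for s
    have S_V: "S s \<subseteq> V" for s by (auto simp: S_def)
    have S_edge: "k \<in> S (Suc s)" if "j \<in> S s" "(j, k) \<in> E (t + s)" for j k s
    proof -
      have k: "k \<in> V" and j: "j \<in> neighbors V (E (t + s)) k"
        using that(2) A1_edges[of "t + s"] A1_sym[of "t + s"] by (auto simp: neighbors_def sym_def)
      have "\<delta> ^ Suc s * e \<le> \<delta> * (m t - x j (t + s))"
        using that(1) \<delta> by (simp add: S_def mult.assoc)
      also have "\<dots> \<le> m t - x k (Suc (t + s))"
        using decseqD[OF m_anti, of t "t + s"] by (intro deficit[OF k j]) simp
      finally show ?thesis using k by (simp add: S_def)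
    qed
    have S_mono: "S s \<subseteq> S s'" if "s \<le> s'" for s s'
      using that
    proof (induction rule: dec_induct)
      case (step n) then show ?case using S_edge[OF _ A1_loops] S_V by (metis subset_eq)
    qed simp
    have grow: "S (\<tau> (Suc k) - t) = V \<or> card (S (\<tau> k - t)) < card (S (\<tau> (Suc k) - t))"
      if k: "t \<le> \<tau> k" and ne: "j \<in> S (\<tau> k - t)" for k j
    proof (cases "S (\<tau> k - t) = V")
      case True
      have "\<tau> k - t \<le> \<tau> (Suc k) - t"
        using strict_mono_less_eq[OF A4_mono, of k "Suc k"] by auto
      from S_mono[OF this] show ?thesis using True S_V[of "\<tau> (Suc k) - t"] by blast
    next
      case False
      then obtain v where v: "v \<in> V" "v \<notin> S (\<tau> k - t)" using S_V by blast
      have "(\<Union>t\<in>{\<tau> k..<\<tau> (Suc k)}. E t) \<subseteq> V \<times> V" using A1_edges by blast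
      from crossing_edge[OF A4_connected S_V ne v this]
      obtain p q where pq: "(p, q) \<in> (\<Union>t\<in>{\<tau> k..<\<tau> (Suc k)}. E t)" "p \<in> S (\<tau> k - t)" "q \<notin> S (\<tau> k - t)" .
      then obtain s where s: "\<tau> k \<le> s" "s < \<tau> (Suc k)" "(p, q) \<in> E s" by auto
      have "\<tau> k - t \<le> s - t" "Suc (s - t) \<le> \<tau> (Suc k) - t" "\<tau> k - t \<le> \<tau> (Suc k) - t"
        using s k by auto
      note mono = this[THEN S_mono]
      have "p \<in> S (s - t)" using pq(2) mono(1) by blast
      then have "q \<in> S (Suc (s - t))" using S_edge[of p "s - t" q] s k by simp
      then have "q \<in> S (\<tau> (Suc k) - t)" using mono(2) by blast
      then have "S (\<tau> k - t) \<subset> S (\<tau> (Suc k) - t)"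
        using pq(3) mono(3) by blast
      then show ?thesis using finite_subset[OF S_V V(1)] by (simp add: psubset_card_mono)
    qed
    have ex: "\<exists>k. t \<le> \<tau> k" using strict_mono_imp_increasing[OF A4_mono] by blast
    define k0 where "k0 = (LEAST k. t \<le> \<tau> k)"
    have k0: "t \<le> \<tau> k0" unfolding k0_def using ex by (rule LeastI_ex)
    have k0_le: "\<tau> k0 \<le> t + \<tau> 0 + B"
    proof (cases k0)
      case (Suc k)
      then have "\<not> t \<le> \<tau> k" using not_less_Least[of k "\<lambda>k. t \<le> \<tau> k"] by (simp add: k0_def)
      then show ?thesis using B[of k] unfolding Suc by linarith
    qed simp
    have le: "\<tau> (k0 + r) \<le> t + \<tau> 0 + Suc r * B" for r
    proof (induction r)
      case (Suc r) then show ?case using B[of "k0 + r"] by simp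
    qed (use k0_le in simp)
    have tk: "t \<le> \<tau> (k0 + r)" for r
      using k0 strict_mono_less_eq[OF A4_mono, of k0 "k0 + r"] by linarith
    have iS: "i \<in> S s" for s
      using S_mono[of 0 s] i by (auto simp: S_def e_def)
    have "S (\<tau> (k0 + r) - t) = V \<or> r \<le> card (S (\<tau> (k0 + r) - t))" for r
    proof (induction r)
      case (Suc r)
      have "\<tau> (k0 + r) - t \<le> \<tau> (k0 + Suc r) - t"
        using strict_mono_less_eq[OF A4_mono, of "k0 + r" "k0 + Suc r"] by auto
      then have "S (\<tau> (k0 + r) - t) \<subseteq> S (\<tau> (k0 + Suc r) - t)" by (rule S_mono)
      moreover have "S (\<tau> (k0 + Suc r) - t) = V \<or>
          card (S (\<tau> (k0 + r) - t)) < card (S (\<tau> (k0 + Suc r) - t))"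
        using grow[OF tk[of r] iS] by simp
      ultimately show ?case using Suc S_V[of "\<tau> (k0 + Suc r) - t"] by (metis Suc_leI le_less_trans subset_antisym)
    qed simp
    from this[of "card V"] have "S (\<tau> (k0 + card V) - t) = V"
      using card_seteq[OF V(1) S_V] by blast
    moreover have "\<tau> (k0 + card V) - t \<le> N" using le[of "card V"] by (simp add: N_def)
    ultimately have "S N = V" using S_mono S_V by blast
    then have "\<delta> ^ N * e \<le> m t - x j (t + N)" if "j \<in> V" for j
      using that unfolding S_def by blast
    then have "x j (t + N) \<le> m t - \<delta> ^ N * e" if "j \<in> V" for j
      using that by fastforce
    then have "m (t + N) \<le> m t - \<delta> ^ N * e" by (rule m_le)
    then show ?thesis by (simp add: e_def)
  qed
  have "x i \<longlonglongrightarrow> l" if i: "i \<in> V" for i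
  proof -
    have "(\<lambda>t. (m t - m (t + N)) / \<delta> ^ N) \<longlonglongrightarrow> (l - l) / \<delta> ^ N"
      using \<delta> by (intro tendsto_intros l LIMSEQ_ignore_initial_segment[OF l]) auto
    then have 0: "(\<lambda>t. (m t - m (t + N)) / \<delta> ^ N) \<longlonglongrightarrow> 0" by simp
    have "(\<lambda>t. m t - x i t) \<longlonglongrightarrow> 0"
    proof (rule tendsto_sandwich[OF _ _ tendsto_const 0])
      show "\<forall>\<^sub>F t in sequentially. 0 \<le> m t - x i t" using x_le[OF i] by simp
      show "\<forall>\<^sub>F t in sequentially. m t - x i t \<le> (m t - m (t + N)) / \<delta> ^ N"
        using main[OF i] \<delta> by (simp add: field_simps)
    qed
    from tendsto_diff[OF l this] show ?thesis by simp
  qed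
  then show "\<exists>l. \<forall>i\<in>V. x i \<longlonglongrightarrow> l" by blast
qed

section \<open>A space-filling curve with a Borel right inverse\<close>

text \<open>
  The distance to the nearest even integer.
\<close>

definition triangle_wave :: "real \<Rightarrow> real" where
  "triangle_wave x = arccos (cos (pi * x)) / pi"

text \<open>
  Schoenberg's function: continuous, with period \<open>2\<close>, equal to \<open>0\<close> on \<open>[0, 1/3]\<close> and to \<open>1\<close> on
  \<open>[2/3, 1]\<close>, so that it tells the first ternary digits \<open>0\<close> and \<open>2\<close> of a point of the Cantor set apart.
\<close>

definition trapezoid_wave :: "real \<Rightarrow> real" where
  "trapezoid_wave x = max 0 (min 1 (3 * triangle_wave x - 1))"

text \<open>
  The point of the Cantor set whose ternary digits are \<open>2 \<beta>\<^sub>0, 2 \<beta>\<^sub>1, \<dots>\<close>.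
\<close>

definition cantor_point :: "(nat \<Rightarrow> real) \<Rightarrow> real" where
  "cantor_point \<beta> = (\<Sum>m. 2 * \<beta> m / 3 ^ Suc m)"

text \<open>
  As a difference of floor functions the digit is visibly Borel in \<open>u\<close>, and the digits telescope.
\<close>

definition binary_digit :: "real \<Rightarrow> nat \<Rightarrow> real" where
  "binary_digit u k = real_of_int \<lfloor>2 ^ Suc k * u\<rfloor> - 2 * real_of_int \<lfloor>2 ^ k * u\<rfloor>"

lemma continuous_triangle_wave: "continuous_on UNIV triangle_wave"
  unfolding triangle_wave_def by (intro continuous_intros) (auto)

lemma continuous_trapezoid_wave: "continuous_on UNIV trapezoid_wave"
  unfolding trapezoid_wave_def by (intro continuous_intros continuous_triangle_wave)

text \<open>
  The shift by even integers makes it possible to use one copy of the Cantor set for every size of cube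
  in the construction of the space-filling curve.
\<close>

lemma triangle_wave_shift:
  assumes "0 \<le> c" "c \<le> 1"
  shows "triangle_wave (2 * real n + c) = c"
proof -
  have e: "pi * (2 * real n + c) = 2 * real n * pi + pi * c" by (simp add: algebra_simps)
  have "cos (pi * (2 * real n + c)) = cos (pi * c)"
    unfolding e cos_add cos_2npi sin_2npi by simp
  moreover have "pi * c \<le> pi" using assms by simp
  ultimately show ?thesis using assms by (simp add: triangle_wave_def arccos_cos)
qed

lemma cantor_summable:
  assumes "\<And>m. \<beta> m \<in> {0, 1::real}"
  shows "summable (\<lambda>m. 2 * \<beta> m / 3 ^ Suc m)"
proof (rule summable_comparison_test)
  show "\<exists>N. \<forall>m\<ge>N. norm (2 * \<beta> m / 3 ^ Suc m) \<le> (2 / 3) * (1 / 3) ^ m"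
  proof (intro exI allI impI)
    fix m show "norm (2 * \<beta> m / 3 ^ Suc m) \<le> (2 / 3) * (1 / 3) ^ m"
      using assms[of m] by (auto simp: power_divide)
  qed
  show "summable (\<lambda>m. (2 / 3) * (1 / 3 :: real) ^ m)" by (intro summable_mult summable_geometric) simp
qed

lemma cantor_point_bounds:
  assumes "\<And>m. \<beta> m \<in> {0, 1::real}"
  shows "0 \<le> cantor_point \<beta>" "cantor_point \<beta> \<le> 1"
proof -
  have b: "0 \<le> \<beta> m" "\<beta> m \<le> 1" for m using assms[of m] by auto
  show "0 \<le> cantor_point \<beta>"
    unfolding cantor_point_def by (rule suminf_nonneg[OF cantor_summable[OF assms]]) (simp add: b)
  have "(\<lambda>m. (2 / 3) * (1 / 3 :: real) ^ m) sums ((2 / 3) * (1 / (1 - 1 / 3)))"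
    by (intro sums_mult geometric_sums) simp
  then have s: "(\<lambda>m. (2 / 3) * (1 / 3 :: real) ^ m) sums 1" by simp
  have "cantor_point \<beta> \<le> (\<Sum>m. (2 / 3) * (1 / 3 :: real) ^ m)"
    unfolding cantor_point_def
    using b by (intro suminf_le cantor_summable assms sums_summable[OF s]) (simp add: power_divide divide_right_mono)
  then show "cantor_point \<beta> \<le> 1" using sums_unique[OF s] by simp
qed

lemma cantor_point_rec:
  assumes "\<And>m. \<beta> m \<in> {0, 1::real}"
  shows "3 * cantor_point \<beta> = 2 * \<beta> 0 + cantor_point (\<lambda>m. \<beta> (Suc m))"
proof -
  have "cantor_point \<beta> = (\<Sum>m. 2 * \<beta> (Suc m) / 3 ^ Suc (Suc m)) + 2 * \<beta> 0 / 3"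
    unfolding cantor_point_def using suminf_split_head[OF cantor_summable[of \<beta>, OF assms]] by simp
  also have "(\<Sum>m. 2 * \<beta> (Suc m) / 3 ^ Suc (Suc m)) = (\<Sum>m. (2 * \<beta> (Suc m) / 3 ^ Suc m) / 3)"
    by simp
  also have "\<dots> = cantor_point (\<lambda>m. \<beta> (Suc m)) / 3"
    unfolding cantor_point_def by (rule suminf_divide[OF cantor_summable[of "\<lambda>m. \<beta> (Suc m)", OF assms]])
  finally show ?thesis by simp
qed

text \<open>
  Multiplication by \<open>3\<close> shifts the ternary digits and adds an even integer, which the periodic function
  does not see.
\<close>

lemma trapezoid_wave_reads_digit:
  assumes "\<And>m. \<beta> m \<in> {0, 1::real}"
  shows "trapezoid_wave (3 ^ N * (2 * real n + cantor_point \<beta>)) = \<beta> N"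
  using assms
proof (induction N arbitrary: n \<beta>)
  case 0
  have c: "0 \<le> cantor_point (\<lambda>m. \<beta> (Suc m))" "cantor_point (\<lambda>m. \<beta> (Suc m)) \<le> 1"
    using cantor_point_bounds[of "\<lambda>m. \<beta> (Suc m)"] 0 by auto
  have "triangle_wave (2 * real n + cantor_point \<beta>) = cantor_point \<beta>"
    using cantor_point_bounds[OF 0] by (rule triangle_wave_shift)
  then show ?case
    using cantor_point_rec[OF 0] c 0[of 0] by (auto simp: trapezoid_wave_def)
next
  case (Suc N)
  obtain b :: nat where b: "\<beta> 0 = real b"
    using Suc.prems[of 0] by (metis empty_iff insert_iff of_nat_0 of_nat_1)
  have "3 ^ Suc N * (2 * real n + cantor_point \<beta>) = 3 ^ N * (6 * real n + 3 * cantor_point \<beta>)"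
    by (simp add: algebra_simps)
  also have "\<dots> = 3 ^ N * (2 * real (3 * n + b) + cantor_point (\<lambda>m. \<beta> (Suc m)))"
    unfolding cantor_point_rec[OF Suc.prems] b by simp
  also have "trapezoid_wave \<dots> = \<beta> (Suc N)"
    by (rule Suc.IH) (rule Suc.prems)
  finally show ?case .
qed

lemma binary_digit_cases: "binary_digit u k \<in> {0, 1}"
proof -
  define x where "x = 2 ^ k * u"
  have "\<lfloor>2 * x\<rfloor> = 2 * \<lfloor>x\<rfloor> \<or> \<lfloor>2 * x\<rfloor> = 2 * \<lfloor>x\<rfloor> + 1" by linarith
  then show ?thesis by (auto simp: binary_digit_def x_def mult.assoc)
qed

text \<open>
  The partial sums telescope to \<open>\<lfloor>2\<^sup>n u\<rfloor> / 2\<^sup>n\<close>.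
\<close>

lemma binary_digit_sums:
  assumes "0 \<le> u" "u < 1"
  shows "(\<lambda>k. binary_digit u k / 2 ^ Suc k) sums u"
proof -
  define F where "F n = real_of_int \<lfloor>2 ^ n * u\<rfloor> / 2 ^ n" for n
  have "F \<longlonglongrightarrow> u"
  proof (rule real_tendsto_sandwich)
    have b: "2 ^ n * u - 1 \<le> real_of_int \<lfloor>2 ^ n * u\<rfloor>" "real_of_int \<lfloor>2 ^ n * u\<rfloor> \<le> 2 ^ n * u" for n
      by linarith+
    have "u - (1 / 2) ^ n \<le> F n" for n
      using divide_right_mono[OF b(1)[of n], of "2 ^ n"]
      by (simp add: F_def diff_divide_distrib power_divide)
    then show "\<forall>\<^sub>F n in sequentially. u - (1 / 2) ^ n \<le> F n" by simp
    show "\<forall>\<^sub>F n in sequentially. F n \<le> u"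
      using b(2) by (auto intro!: always_eventually simp: F_def field_simps)
    have "(\<lambda>n. u - (1 / 2) ^ n) \<longlonglongrightarrow> u - 0"
      by (intro tendsto_intros LIMSEQ_power_zero) simp
    then show "(\<lambda>n. u - (1 / 2) ^ n) \<longlonglongrightarrow> u" by simp
  qed simp
  from telescope_sums[OF this]
  have "(\<lambda>n. F (Suc n) - F n) sums (u - F 0)" .
  moreover have "F 0 = 0" using assms by (simp add: F_def floor_eq_iff)
  moreover have "F (Suc n) - F n = binary_digit u n / 2 ^ Suc n" for n
    by (simp add: F_def binary_digit_def field_simps)
  ultimately show ?thesis by simp
qed

text \<open>
  Schoenberg's curve, stretched to the whole space. A point \<open>y\<close> of norm less than \<open>m\<close> is rescaled into
  the unit cube, the binary digits of its coordinates are interleaved by the pairing function into the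
  ternary digits of a point \<open>c\<close> of the Cantor set, and \<open>\<sigma> y = 2 m + c\<close>. On \<open>[2 m, 2 m + 1]\<close> the curve
  recovers the coordinates and scales them by \<open>x - triangle_wave x = 2 m\<close>. The bound on \<open>\<sigma>\<close> transfers
  tightness from the space to the line.
\<close>

lemma space_filling_curve:
  obtains g :: "real \<Rightarrow> 'a::euclidean_space" and \<sigma> :: "'a \<Rightarrow> real"
  where "continuous_on UNIV g" "\<sigma> \<in> borel_measurable borel" "\<And>y. g (\<sigma> y) = y"
    "\<And>y. \<bar>\<sigma> y\<bar> \<le> 2 * norm y + 3"
proof -
  \<comment> \<open>the position at which the \<open>k\<close>-th binary digit of coordinate \<open>b\<close> is stored\<close>
  define slot where "slot b k = prod_encode (to_nat_on Basis b, k)" for b :: 'a and k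
  define coord :: "'a \<Rightarrow> real \<Rightarrow> real"
    where "coord b x = (\<Sum>k. trapezoid_wave (3 ^ slot b k * x) / 2 ^ Suc k)" for b x
  define g :: "real \<Rightarrow> 'a"
    where "g x = (x - triangle_wave x) *\<^sub>R (\<Sum>b\<in>Basis. (2 * coord b x - 1) *\<^sub>R b)" for x
  define m :: "'a \<Rightarrow> real" where "m y = real_of_int \<lfloor>norm y\<rfloor> + 1" for y
  define u :: "'a \<Rightarrow> 'a \<Rightarrow> real" where "u y b = ((y \<bullet> b) / (2 * m y) + 1) / 2" for y b
  define \<beta> :: "'a \<Rightarrow> nat \<Rightarrow> real"
    where "\<beta> y j = binary_digit (u y (from_nat_into Basis (fst (prod_decode j)))) (snd (prod_decode j))" for y j
  define \<sigma> where "\<sigma> y = 2 * m y + cantor_point (\<beta> y)" for y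
  have \<beta>: "\<beta> y j \<in> {0, 1}" for y j unfolding \<beta>_def by (rule binary_digit_cases)
  have wave: "0 \<le> trapezoid_wave x" "trapezoid_wave x \<le> 1" for x by (auto simp: trapezoid_wave_def)
  have geo: "summable (\<lambda>k. 1 / 2 ^ Suc k :: real)"
    using summable_mult[OF summable_geometric[of "1/2::real"], of "1/2"] by (simp add: power_divide)
  have "continuous_on UNIV (coord b)" for b
  proof (rule uniform_limit_theorem)
    show "uniform_limit UNIV (\<lambda>n x. \<Sum>k<n. trapezoid_wave (3 ^ slot b k * x) / 2 ^ Suc k) (coord b) sequentially"
      unfolding coord_def
      by (rule Weierstrass_m_test[OF _ geo]) (use wave in \<open>simp add: divide_right_mono\<close>)
    show "\<forall>\<^sub>F n in sequentially. continuous_on UNIV (\<lambda>x. \<Sum>k<n. trapezoid_wave (3 ^ slot b k * x) / 2 ^ Suc k)"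
      by (intro always_eventually allI continuous_intros
          continuous_on_compose2[OF continuous_trapezoid_wave]) auto
  qed simp
  then have 1: "continuous_on UNIV g"
    unfolding g_def by (intro continuous_intros continuous_triangle_wave) 
  have "\<And>b k. (\<lambda>y. binary_digit (u y b) k) \<in> borel_measurable borel"
    unfolding binary_digit_def u_def m_def by measurable
  then have 2: "\<sigma> \<in> borel_measurable borel"
    unfolding \<sigma>_def cantor_point_def \<beta>_def m_def by measurable
  have m: "m y > norm y" "m y \<ge> 1" "m y \<le> norm y + 1" for y
    unfolding m_def using floor_correct[of "norm y"] by auto
  have m_nat: "\<exists>n. m y = real n" for y
    unfolding m_def by (rule exI[of _ "nat \<lfloor>norm y\<rfloor> + 1"]) simp
  have c: "0 \<le> cantor_point (\<beta> y)" "cantor_point (\<beta> y) \<le> 1" for y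
    using cantor_point_bounds[of "\<beta> y", OF \<beta>] by auto
  have 3: "g (\<sigma> y) = y" for y
  proof -
    obtain n where n: "m y = real n" using m_nat by blast
    have "coord b (\<sigma> y) = u y b" if b: "b \<in> Basis" for b
    proof -
      have "\<beta> y (slot b k) = binary_digit (u y b) k" for k
        using b by (simp add: \<beta>_def slot_def countable_finite)
      then have "coord b (\<sigma> y) = (\<Sum>k. binary_digit (u y b) k / 2 ^ Suc k)"
        unfolding coord_def \<sigma>_def n trapezoid_wave_reads_digit[of "\<beta> y", OF \<beta>] by simp
      also have "\<dots> = u y b"
      proof (rule sums_unique[OF binary_digit_sums, symmetric])
        have "\<bar>y \<bullet> b\<bar> < 2 * m y" using Basis_le_norm[OF b, of y] m(1,2)[of y] by linarith
        then have "\<bar>(y \<bullet> b) / (2 * m y)\<bar> < 1" using m(2)[of y] by simp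
        moreover have "0 \<le> (r + 1) / 2 \<and> (r + 1) / 2 < 1" if "\<bar>r\<bar> < 1" for r :: real
          using that by auto
        ultimately show "0 \<le> u y b" "u y b < 1" unfolding u_def by blast+
      qed
      finally show ?thesis .
    qed
    moreover have aux: "2 * c - 1 = r" if "c = (r + 1) / 2" for r c :: real using that by simp
    ultimately have "2 * coord b (\<sigma> y) - 1 = (y \<bullet> b) / (2 * m y)" if "b \<in> Basis" for b
      using that unfolding u_def by metis
    then have "(\<Sum>b\<in>Basis. (2 * coord b (\<sigma> y) - 1) *\<^sub>R b) = (\<Sum>b\<in>Basis. ((y \<bullet> b) / (2 * m y)) *\<^sub>R b)"
      by (intro sum.cong refl) simp
    also have "\<dots> = (1 / (2 * m y)) *\<^sub>R y"
      using arg_cong[OF euclidean_representation[of y], of "\<lambda>v. (1 / (2 * m y)) *\<^sub>R v"]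
      by (simp add: scaleR_sum_right)
    finally have *: "(\<Sum>b\<in>Basis. (2 * coord b (\<sigma> y) - 1) *\<^sub>R b) = (1 / (2 * m y)) *\<^sub>R y" .
    have "\<sigma> y - triangle_wave (\<sigma> y) = 2 * m y"
      using triangle_wave_shift[OF c(1)[of y] c(2)[of y], of n] unfolding \<sigma>_def n by simp
    then show ?thesis unfolding g_def * using m(2)[of y] by simp
  qed
  have 4: "\<bar>\<sigma> y\<bar> \<le> 2 * norm y + 3" for y
    using c[of y] m(2,3)[of y] by (simp add: \<sigma>_def)
  show thesis by (rule that[OF 1 2 3 4])
qed

section \<open>Compactness for the quadratic Wasserstein distance\<close>

lemma Fatou_bound:
  fixes f :: "nat \<Rightarrow> 'a \<Rightarrow> real"
  assumes int: "\<And>k. integrable M (f k)" and nn: "\<And>k x. 0 \<le> f k x"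
    and lim: "\<And>x. x \<in> space M \<Longrightarrow> (\<lambda>k. f k x) \<longlonglongrightarrow> g x"
    and le: "\<And>k. (\<integral>x. f k x \<partial>M) \<le> c"
  shows "integrable M g" "(\<integral>x. g x \<partial>M) \<le> c"
proof -
  have c: "0 \<le> c" using order_trans[OF Bochner_Integration.integral_nonneg[of M "f 0", OF nn] le] .
  have g0: "0 \<le> g x" if "x \<in> space M" for x
    using lim[OF that] by (rule LIMSEQ_le_const) (auto intro: nn)
  have gm: "g \<in> borel_measurable M" by (rule borel_measurable_LIMSEQ_real[OF lim borel_measurable_integrable[OF int]])
  have "(\<integral>\<^sup>+x. ennreal (g x) \<partial>M) = (\<integral>\<^sup>+x. liminf (\<lambda>k. ennreal (f k x)) \<partial>M)"
    using lim by (intro nn_integral_cong) (simp add: lim_imp_Liminf[symmetric] tendsto_ennrealI)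
  also have "\<dots> \<le> liminf (\<lambda>k. \<integral>\<^sup>+x. ennreal (f k x) \<partial>M)"
    using int by (intro nn_integral_liminf) auto
  also have "\<dots> \<le> ennreal c"
  proof (rule Liminf_le)
    show "\<forall>\<^sub>F k in sequentially. (\<integral>\<^sup>+x. ennreal (f k x) \<partial>M) \<le> ennreal c"
      using le nn_integral_eq_integral[OF int] nn by (simp add: ennreal_leI)
  qed simp
  finally have *: "(\<integral>\<^sup>+x. ennreal (g x) \<partial>M) \<le> ennreal c" .
  show i: "integrable M g"
  proof (rule integrableI_nonneg[OF gm])
    show "(\<integral>\<^sup>+x. ennreal (g x) \<partial>M) < \<infinity>" using * by (rule order_le_less_trans) simp
  qed (use g0 in simp)
  show "(\<integral>x. g x \<partial>M) \<le> c"
    using * nn_integral_eq_integral[OF i] g0 c by (simp add: AE_I2 ennreal_le_iff)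
qed

text \<open>
  The tail of \<open>|x|\<^sup>2\<close> is measured by \<open>max (|x|\<^sup>2 - R) 0\<close> rather than by a cut-off at \<open>R\<close>, since this
  integrand is convex and so is controlled along barycenters.
\<close>

definition uniformly_square_integrable :: "'i set \<Rightarrow> ('i \<Rightarrow> 'a::euclidean_space measure) \<Rightarrow> bool" where
  "uniformly_square_integrable I \<alpha> \<longleftrightarrow>
     (\<forall>e>0. \<exists>R\<ge>0. \<forall>i\<in>I. (\<integral>x. max ((norm x)\<^sup>2 - R) 0 \<partial>\<alpha> i) \<le> e)"

text \<open>
  The factor \<open>4\<close> makes the two levels \<open>R\<close> on the right absorb the level on the left.
\<close>

lemma truncated_difference_le:
  fixes x y :: "'a::real_inner"
  shows "max ((norm (x - y))\<^sup>2 - 4 * R) 0 \<le> 2 * max ((norm x)\<^sup>2 - R) 0 + 2 * max ((norm y)\<^sup>2 - R) 0"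
  using norm_diff_sq_le[of x y] by (simp add: max_def)

text \<open>
  Vitali's theorem for \<open>L\<^sup>2\<close>: the part of \<open>|X\<^sub>k - Y|\<^sup>2\<close> below the level \<open>4 R\<close> tends to \<open>0\<close> by dominated
  convergence, and the part above it is controlled by the tails of \<open>|X\<^sub>k|\<^sup>2\<close> and \<open>|Y|\<^sup>2\<close>.
\<close>

lemma mean_square_convergence:
  fixes X :: "nat \<Rightarrow> 'b \<Rightarrow> 'a::euclidean_space"
  assumes "prob_space \<Omega>"
    and X: "\<And>k. X k \<in> borel_measurable \<Omega>" and Y: "Y \<in> borel_measurable \<Omega>"
    and int: "\<And>k. integrable \<Omega> (\<lambda>\<omega>. (norm (X k \<omega>))\<^sup>2)"
    and UI: "\<And>e. e > 0 \<Longrightarrow> \<exists>R\<ge>0. \<forall>k. (\<integral>\<omega>. max ((norm (X k \<omega>))\<^sup>2 - R) 0 \<partial>\<Omega>) \<le> e"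
    and lim: "\<And>\<omega>. \<omega> \<in> space \<Omega> \<Longrightarrow> (\<lambda>k. X k \<omega>) \<longlonglongrightarrow> Y \<omega>"
  shows "integrable \<Omega> (\<lambda>\<omega>. (norm (Y \<omega>))\<^sup>2)"
    and "(\<lambda>k. \<integral>\<omega>. (norm (X k \<omega> - Y \<omega>))\<^sup>2 \<partial>\<Omega>) \<longlonglongrightarrow> 0"
proof -
  interpret prob_space \<Omega> by fact
  note [measurable] = X Y
  have intR: "integrable \<Omega> (\<lambda>\<omega>. max ((norm (X k \<omega>))\<^sup>2 - R) 0)" for k R
    using int[of k] by (intro Bochner_Integration.integrable_max) auto
  obtain R0 where R0: "R0 \<ge> 0" "\<And>k. (\<integral>\<omega>. max ((norm (X k \<omega>))\<^sup>2 - R0) 0 \<partial>\<Omega>) \<le> 1" using UI[of 1] by auto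
  have bound: "(\<integral>\<omega>. (norm (X k \<omega>))\<^sup>2 \<partial>\<Omega>) \<le> R0 + 1" for k
  proof -
    have "(\<integral>\<omega>. (norm (X k \<omega>))\<^sup>2 \<partial>\<Omega>) \<le> (\<integral>\<omega>. R0 + max ((norm (X k \<omega>))\<^sup>2 - R0) 0 \<partial>\<Omega>)"
      using int[of k] intR[of k R0] by (intro integral_mono) auto
    also have "\<dots> \<le> R0 + 1" using intR[of k R0] R0(2)[of k] by (simp add: prob_space)
    finally show ?thesis .
  qed
  show intY: "integrable \<Omega> (\<lambda>\<omega>. (norm (Y \<omega>))\<^sup>2)"
    by (rule Fatou_bound(1)[OF int _ _ bound]) (auto intro!: tendsto_intros lim)
  have intYR: "integrable \<Omega> (\<lambda>\<omega>. max ((norm (Y \<omega>))\<^sup>2 - R) 0)" for R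
    using intY by (intro Bochner_Integration.integrable_max) auto
  have intD: "integrable \<Omega> (\<lambda>\<omega>. (norm (X k \<omega> - Y \<omega>))\<^sup>2)" for k
  proof (rule Bochner_Integration.integrable_bound)
    show "integrable \<Omega> (\<lambda>\<omega>. 2 * (norm (X k \<omega>))\<^sup>2 + 2 * (norm (Y \<omega>))\<^sup>2)" using int intY by simp
  qed (auto intro!: AE_I2 simp: norm_diff_sq_le)
  have intDR: "integrable \<Omega> (\<lambda>\<omega>. max ((norm (X k \<omega> - Y \<omega>))\<^sup>2 - R) 0)" for k R
    using intD by (intro Bochner_Integration.integrable_max) auto
  show "(\<lambda>k. \<integral>\<omega>. (norm (X k \<omega> - Y \<omega>))\<^sup>2 \<partial>\<Omega>) \<longlonglongrightarrow> 0"
  proof (rule order_tendstoI)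
    fix e :: real assume e: "0 < e"
    obtain R where R: "R \<ge> 0" "\<And>k. (\<integral>\<omega>. max ((norm (X k \<omega>))\<^sup>2 - R) 0 \<partial>\<Omega>) \<le> e / 8"
      using UI[of "e / 8"] e by auto
    have RY: "(\<integral>\<omega>. max ((norm (Y \<omega>))\<^sup>2 - R) 0 \<partial>\<Omega>) \<le> e / 8"
      by (rule Fatou_bound(2)[OF intR _ _ R(2)]) (auto intro!: tendsto_intros lim)
    define D where "D k \<omega> = min ((norm (X k \<omega> - Y \<omega>))\<^sup>2) (4 * R)" for k \<omega>
    have D_bound: "\<bar>D k \<omega>\<bar> \<le> 4 * R" for k \<omega>
      using R(1) by (simp add: D_def abs_of_nonneg)
    have "(\<lambda>k. \<integral>\<omega>. D k \<omega> \<partial>\<Omega>) \<longlonglongrightarrow> (\<integral>\<omega>. 0 \<partial>\<Omega>)"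
    proof (rule integral_dominated_convergence[where w="\<lambda>_. 4 * R"])
      show "AE \<omega> in \<Omega>. (\<lambda>k. D k \<omega>) \<longlonglongrightarrow> 0"
      proof (rule AE_I2)
        fix \<omega> assume "\<omega> \<in> space \<Omega>"
        then have "(\<lambda>k. D k \<omega>) \<longlonglongrightarrow> min ((norm (Y \<omega> - Y \<omega>))\<^sup>2) (4 * R)"
          unfolding D_def by (intro tendsto_intros lim)
        then show "(\<lambda>k. D k \<omega>) \<longlonglongrightarrow> 0" using R(1) by simp
      qed
    qed (use R(1) D_bound in \<open>auto simp: D_def\<close>)
    then have "\<forall>\<^sub>F k in sequentially. (\<integral>\<omega>. D k \<omega> \<partial>\<Omega>) < e / 2"
      using e by (intro order_tendstoD(2)[where y=0]) auto
    then show "\<forall>\<^sub>F k in sequentially. (\<integral>\<omega>. (norm (X k \<omega> - Y \<omega>))\<^sup>2 \<partial>\<Omega>) < e"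
    proof eventually_elim
      case (elim k)
      have iD: "integrable \<Omega> (D k)"
        unfolding D_def using intD by (intro Bochner_Integration.integrable_min) auto
      have "(\<integral>\<omega>. (norm (X k \<omega> - Y \<omega>))\<^sup>2 \<partial>\<Omega>) = (\<integral>\<omega>. D k \<omega> + max ((norm (X k \<omega> - Y \<omega>))\<^sup>2 - 4 * R) 0 \<partial>\<Omega>)"
        by (intro Bochner_Integration.integral_cong) (auto simp: D_def)
      also have "\<dots> = (\<integral>\<omega>. D k \<omega> \<partial>\<Omega>) + (\<integral>\<omega>. max ((norm (X k \<omega> - Y \<omega>))\<^sup>2 - 4 * R) 0 \<partial>\<Omega>)"
        using iD intDR by (rule Bochner_Integration.integral_add)
      also have "(\<integral>\<omega>. max ((norm (X k \<omega> - Y \<omega>))\<^sup>2 - 4 * R) 0 \<partial>\<Omega>)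
          \<le> (\<integral>\<omega>. 2 * max ((norm (X k \<omega>))\<^sup>2 - R) 0 + 2 * max ((norm (Y \<omega>))\<^sup>2 - R) 0 \<partial>\<Omega>)"
        using intDR intR intYR truncated_difference_le
        by (intro integral_mono Bochner_Integration.integrable_add integrable_mult_right) auto
      also have "\<dots> \<le> e / 2" using intR intYR R(2)[of k] RY by simp
      finally show ?case using elim by simp
    qed
  next
    fix e :: real assume "e < 0"
    then show "\<forall>\<^sub>F k in sequentially. e < (\<integral>\<omega>. (norm (X k \<omega> - Y \<omega>))\<^sup>2 \<partial>\<Omega>)"
      by (intro always_eventually allI) (auto intro: less_le_trans)
  qed
qed

text \<open>
  The images of the measures under the right inverse \<open>\<sigma>\<close> of the space-filling curve \<open>g\<close> are tight on the
  line, so a subsequence converges weakly and is represented by pointwise convergent random variables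
  \<open>Y\<^sub>k\<close>. By continuity \<open>X\<^sub>k = g(Y\<^sub>k)\<close> converges pointwise too, and its law is the original measure because
  \<open>g(\<sigma>(x)) = x\<close>. The pairs of \<open>X\<^sub>k\<close> and its limit are the couplings that witness convergence.
\<close>

lemma Wasserstein_compactness:
  fixes \<alpha> :: "nat \<Rightarrow> 'a::euclidean_space measure"
  assumes \<alpha>: "\<And>k. \<alpha> k \<in> finite_moment_measures 2" and UI: "uniformly_square_integrable UNIV \<alpha>"
  obtains r \<beta> where "strict_mono r" "\<beta> \<in> finite_moment_measures 2"
    "(\<lambda>k. wasserstein 2 (\<alpha> (r k)) \<beta>) \<longlonglongrightarrow> 0"
proof -
  obtain g :: "real \<Rightarrow> 'a" and \<sigma> :: "'a \<Rightarrow> real"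
    where gc: "continuous_on UNIV g" and \<sigma>[measurable]: "\<sigma> \<in> borel_measurable borel"
      and g\<sigma>: "\<And>y. g (\<sigma> y) = y" and \<sigma>_bound: "\<And>y. \<bar>\<sigma> y\<bar> \<le> 2 * norm y + 3"
    using space_filling_curve by blast
  have g[measurable]: "g \<in> borel_measurable borel" using gc by (rule borel_measurable_continuous_onI)
  have ps: "prob_space (\<alpha> k)" and s: "sets (\<alpha> k) = sets borel"
    and int: "integrable (\<alpha> k) (\<lambda>x. (norm x)\<^sup>2)" for k
    using \<alpha>[of k] by (auto simp: finite_second_moment_iff)
  have sp: "space (\<alpha> k) = UNIV" for k using s[of k] by (metis sets_eq_imp_space_eq space_borel)
  have \<sigma>k: "\<sigma> \<in> borel_measurable (\<alpha> k)" for k by (simp add: borel_measurable_borel_sets[OF s])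
  have intR: "integrable (\<alpha> k) (\<lambda>x. max ((norm x)\<^sup>2 - R) 0)" for k R
  proof -
    interpret prob_space "\<alpha> k" by (rule ps)
    show ?thesis using int[of k] by (intro Bochner_Integration.integrable_max) auto
  qed
  obtain R where R: "R \<ge> 0" "\<And>k. (\<integral>x. max ((norm x)\<^sup>2 - R) 0 \<partial>\<alpha> k) \<le> 1"
    using UI unfolding uniformly_square_integrable_def by (metis UNIV_I zero_less_one)
  define C where "C = R + 1"
  have C: "(\<integral>x. (norm x)\<^sup>2 \<partial>\<alpha> k) \<le> C" for k
  proof -
    interpret prob_space "\<alpha> k" by (rule ps)
    have "(\<integral>x. (norm x)\<^sup>2 \<partial>\<alpha> k) \<le> (\<integral>x. R + max ((norm x)\<^sup>2 - R) 0 \<partial>\<alpha> k)"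
      using int[of k] intR[of k R] by (intro integral_mono) auto
    also have "\<dots> \<le> C" using intR[of k R] R(2)[of k] by (simp add: prob_space C_def)
    finally show ?thesis .
  qed
  have C1: "C \<ge> 1" using R(1) by (simp add: C_def)
  define \<rho> where "\<rho> k = distr (\<alpha> k) borel \<sigma>" for k
  have rd: "real_distribution (\<rho> k)" for k
    unfolding \<rho>_def by (rule prob_space.real_distribution_distr[OF ps \<sigma>k])
  have "tight \<rho>"
    unfolding tight_def
  proof (intro conjI allI impI rd)
    fix e :: real assume e: "0 < e"
    \<comment> \<open>by Markov's inequality, at most the mass \<open>e / 2\<close> lies at distance \<open>q\<close> or more from the origin\<close>
    define q where "q = sqrt (2 * C / e)"
    have q2: "q\<^sup>2 = 2 * C / e" using e C1 by (simp add: q_def)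
    have q0: "0 < q" using e C1 by (simp add: q_def)
    define b where "b = 2 * q + 3"
    have "measure (\<rho> k) {- b - 1<..b} > 1 - e" for k
    proof -
      interpret prob_space "\<alpha> k" by (rule ps)
      have ms: "{x. \<sigma> x \<in> {- b - 1<..b}} \<in> sets (\<alpha> k)"
        using measurable_sets[OF \<sigma>k[of k], of "{- b - 1<..b}"] by (simp add: sp vimage_def)
      have mq: "{x. q\<^sup>2 \<le> (norm x)\<^sup>2} \<in> sets (\<alpha> k)" unfolding s by measurable
      have "measure (\<alpha> k) {x \<in> space (\<alpha> k). (norm x)\<^sup>2 \<ge> q\<^sup>2} \<le> (\<integral>x. (norm x)\<^sup>2 \<partial>\<alpha> k) / q\<^sup>2"
        using q0 int by (intro integral_Markov_inequality_measure[where A="{}"]) auto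
      also have "\<dots> \<le> C / q\<^sup>2" using C q0 by (intro divide_right_mono) auto
      also have "\<dots> < e" using q2 e C1 by simp
      finally have *: "measure (\<alpha> k) {x. (norm x)\<^sup>2 \<ge> q\<^sup>2} < e" by (simp add: sp)
      have "UNIV - {x. \<sigma> x \<in> {- b - 1<..b}} \<subseteq> {x. (norm x)\<^sup>2 \<ge> q\<^sup>2}"
      proof
        fix x assume "x \<in> UNIV - {x. \<sigma> x \<in> {- b - 1<..b}}"
        then have "\<bar>\<sigma> x\<bar> \<ge> b" by auto
        then have "q \<le> norm x" using \<sigma>_bound[of x] by (simp add: b_def)
        then show "x \<in> {x. (norm x)\<^sup>2 \<ge> q\<^sup>2}" using q0 by simp
      qed
      then have "measure (\<alpha> k) (UNIV - {x. \<sigma> x \<in> {- b - 1<..b}}) < e"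
        using finite_measure_mono[OF _ mq] * by (meson order_le_less_trans)
      then have "measure (\<alpha> k) {x. \<sigma> x \<in> {- b - 1<..b}} > 1 - e"
        using prob_compl[OF ms] by (simp add: sp)
      then show ?thesis
        unfolding \<rho>_def by (subst measure_distr[OF \<sigma>k]) (auto simp: sp vimage_def)
    qed
    moreover have "- b - 1 < b" using q0 by (simp add: b_def)
    ultimately show "\<exists>a b. a < b \<and> (\<forall>k. 1 - e < measure (\<rho> k) {a<..b})" by blast
  qed
  from tight_imp_convergent_subsubsequence[OF this strict_mono_id]
  obtain r M where r: "strict_mono r" and M: "real_distribution M" and conv: "weak_conv_m (\<rho> \<circ> r) M"
    by auto
  obtain \<Omega> :: "real measure" and Y_seq Y where \<Omega>: "prob_space \<Omega>"
    and Ym[measurable]: "\<And>n. Y_seq n \<in> measurable \<Omega> borel" and Yd: "\<And>n. distr \<Omega> borel (Y_seq n) = \<rho> (r n)"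
    and Y: "Y \<in> measurable \<Omega> lborel" and lim: "\<And>x. x \<in> space \<Omega> \<Longrightarrow> (\<lambda>n. Y_seq n x) \<longlonglongrightarrow> Y x"
    using Skorohod[OF _ M conv] rd unfolding o_def by metis
  have Y'[measurable]: "Y \<in> borel_measurable \<Omega>" using Y by simp
  interpret \<Omega>: prob_space \<Omega> by (rule \<Omega>)
  define X where "X k \<omega> = g (Y_seq k \<omega>)" for k \<omega>
  define Z where "Z \<omega> = g (Y \<omega>)" for \<omega>
  have Xm[measurable]: "X k \<in> borel_measurable \<Omega>" for k unfolding X_def by measurable
  have Zm[measurable]: "Z \<in> borel_measurable \<Omega>" unfolding Z_def by measurable
  have Xd: "distr \<Omega> borel (X k) = \<alpha> (r k)" for k
  proof -
    have "distr \<Omega> borel (X k) = distr (distr \<Omega> borel (Y_seq k)) borel g"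
      by (subst distr_distr[OF g Ym]) (simp add: o_def X_def[abs_def])
    also have "\<dots> = distr (\<alpha> (r k)) borel (\<lambda>x. x)"
      unfolding Yd \<rho>_def by (subst distr_distr[OF g \<sigma>k]) (simp add: o_def g\<sigma>)
    also have "\<dots> = \<alpha> (r k)" using s[of "r k"] by (intro distr_id2) simp
    finally show ?thesis .
  qed
  have limX: "(\<lambda>k. X k \<omega>) \<longlonglongrightarrow> Z \<omega>" if "\<omega> \<in> space \<Omega>" for \<omega>
    unfolding X_def Z_def using gc lim[OF that]
    by (intro continuous_on_tendsto_compose[OF gc]) auto
  have norm_m: "(\<lambda>x::'a. (norm x)\<^sup>2) \<in> borel_measurable borel" by measurable
  have normR_m: "(\<lambda>x::'a. max ((norm x)\<^sup>2 - R) 0) \<in> borel_measurable borel" for R by measurable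
  have intX: "integrable \<Omega> (\<lambda>\<omega>. (norm (X k \<omega>))\<^sup>2)" for k
    using int[of "r k"] unfolding Xd[symmetric] integrable_distr_eq[OF Xm norm_m] .
  have UIX: "\<exists>R\<ge>0. \<forall>k. (\<integral>\<omega>. max ((norm (X k \<omega>))\<^sup>2 - R) 0 \<partial>\<Omega>) \<le> e" if e: "e > 0" for e
  proof -
    obtain R where R: "R \<ge> 0" "\<And>k. (\<integral>x. max ((norm x)\<^sup>2 - R) 0 \<partial>\<alpha> k) \<le> e"
      using UI e by (auto simp: uniformly_square_integrable_def)
    have "(\<integral>\<omega>. max ((norm (X k \<omega>))\<^sup>2 - R) 0 \<partial>\<Omega>) \<le> e" for k
      using R(2)[of "r k"] unfolding Xd[symmetric] integral_distr[OF Xm normR_m] .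
    then show ?thesis using R(1) by blast
  qed
  note ms = mean_square_convergence[OF \<Omega> Xm Zm intX UIX limX]
  define \<beta> where "\<beta> = distr \<Omega> borel Z"
  have \<beta>: "\<beta> \<in> finite_moment_measures 2"
    using ms(1) \<Omega>.prob_space_distr[OF Zm] by (simp add: \<beta>_def finite_second_moment_iff integrable_distr_eq)
  have W: "(wasserstein 2 (\<alpha> (r k)) \<beta>)\<^sup>2 \<le> (\<integral>\<omega>. (norm (X k \<omega> - Z \<omega>))\<^sup>2 \<partial>\<Omega>)" for k
  proof -
    have P[measurable]: "(\<lambda>\<omega>. (X k \<omega>, Z \<omega>)) \<in> borel_measurable \<Omega>"
      unfolding borel_prod[symmetric] by measurable
    have f: "fst \<in> borel_measurable (borel :: ('a \<times> 'a) measure)" "snd \<in> borel_measurable (borel :: ('a \<times> 'a) measure)"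
      by (intro borel_measurable_continuous_onI continuous_on_fst continuous_on_snd continuous_on_id)+
    have "distr \<Omega> borel (\<lambda>\<omega>. (X k \<omega>, Z \<omega>)) \<in> couplings (\<alpha> (r k)) \<beta>"
      using \<Omega>.prob_space_distr[OF P] unfolding couplings_def prob_measures_def \<beta>_def Xd[symmetric]
      by (simp add: distr_distr[OF f(1) P] distr_distr[OF f(2) P] o_def)
    from wasserstein_2_sq_le[OF \<alpha> \<beta> this]
    have "(wasserstein 2 (\<alpha> (r k)) \<beta>)\<^sup>2 \<le> sq_cost (distr \<Omega> borel (\<lambda>\<omega>. (X k \<omega>, Z \<omega>)))" .
    also have "(\<lambda>z::'a\<times>'a. (norm (fst z - snd z))\<^sup>2) \<in> borel_measurable borel"
      by (intro borel_measurable_continuous_onI continuous_intros)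
    then have "sq_cost (distr \<Omega> borel (\<lambda>\<omega>. (X k \<omega>, Z \<omega>))) = (\<integral>\<omega>. (norm (X k \<omega> - Z \<omega>))\<^sup>2 \<partial>\<Omega>)"
      unfolding sq_cost_def by (subst integral_distr[OF P]) auto
    finally show ?thesis .
  qed
  have "(\<lambda>k. (wasserstein 2 (\<alpha> (r k)) \<beta>)\<^sup>2) \<longlonglongrightarrow> 0"
    by (rule tendsto_sandwich[OF _ _ tendsto_const ms(2)]) (use W in \<open>auto intro: always_eventually\<close>)
  from tendsto_real_sqrt[OF this] have "(\<lambda>k. wasserstein 2 (\<alpha> (r k)) \<beta>) \<longlonglongrightarrow> 0"
    by (simp add: wasserstein_nonneg)
  with r \<beta> show thesis by (rule that)
qed

section \<open>Convex Lipschitz functions determine a measure\<close>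

text \<open>
  Bounded subgradients amount to Lipschitz continuity. The subgradient selection stays hidden, so that
  the class can be closed under maxima.
\<close>

definition convex_lipschitz :: "('a::euclidean_space \<Rightarrow> real) \<Rightarrow> bool" where
  "convex_lipschitz \<psi> \<longleftrightarrow> \<psi> \<in> borel_measurable borel \<and>
     (\<exists>\<xi> K. \<xi> \<in> borel_measurable borel \<and> (\<forall>x. norm (\<xi> x) \<le> K) \<and> (\<forall>x y. \<psi> y + \<xi> y \<bullet> (x - y) \<le> \<psi> x))"

lemma convex_lipschitzI:
  assumes "\<psi> \<in> borel_measurable borel" "\<xi> \<in> borel_measurable borel"
    "\<And>x. norm (\<xi> x) \<le> K" "\<And>x y. \<psi> y + \<xi> y \<bullet> (x - y) \<le> \<psi> x"
  shows "convex_lipschitz \<psi>"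
  using assms unfolding convex_lipschitz_def by blast

lemma convex_lipschitz_has_subgradient:
  assumes "convex_lipschitz \<psi>"
  obtains \<xi> K where "has_subgradient \<psi> \<xi> K"
proof -
  obtain \<xi> K where *: "\<psi> \<in> borel_measurable borel" "\<xi> \<in> borel_measurable borel"
    "\<And>x. norm (\<xi> x) \<le> K" "\<And>x y. \<psi> y + \<xi> y \<bullet> (x - y) \<le> \<psi> x"
    using assms unfolding convex_lipschitz_def by blast
  have "0 \<le> K" using order_trans[OF norm_ge_zero *(3)] .
  then have "K \<le> K * (1 + norm x)" for x :: 'a by (simp add: algebra_simps)
  then have "has_subgradient \<psi> \<xi> K"
    unfolding has_subgradient_def using * order_trans by blast
  then show thesis by (rule that)
qed

lemma convex_lipschitz_imp_lipschitz:
  assumes "convex_lipschitz \<psi>"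
  obtains K where "0 \<le> K" "\<And>x y. \<bar>\<psi> x - \<psi> y\<bar> \<le> K * norm (x - y)"
proof -
  obtain \<xi> K where *: "\<And>x. norm (\<xi> x) \<le> K" "\<And>x y. \<psi> y + \<xi> y \<bullet> (x - y) \<le> \<psi> x"
    using assms unfolding convex_lipschitz_def by blast
  have K: "0 \<le> K" using order_trans[OF norm_ge_zero *(1)] .
  have "\<psi> y - \<psi> x \<le> K * norm (x - y)" for x y
  proof -
    have "\<psi> y - \<psi> x \<le> - (\<xi> y \<bullet> (x - y))" using *(2)[of y x] by simp
    also have "\<dots> \<le> norm (\<xi> y) * norm (x - y)" using Cauchy_Schwarz_ineq2[of "\<xi> y" "x - y"] by simp
    also have "\<dots> \<le> K * norm (x - y)" using *(1) by (intro mult_right_mono) auto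
    finally show ?thesis .
  qed
  from this[of _ _] this[of _ _] have "\<bar>\<psi> x - \<psi> y\<bar> \<le> K * norm (x - y)" for x y
    by (smt (verit) norm_minus_commute)
  with K show thesis by (rule that)
qed

lemma convex_lipschitz_halfspace: "convex_lipschitz (\<lambda>x. x \<bullet> i - a)"
  by (rule convex_lipschitzI[where \<xi>="\<lambda>_. i" and K="norm i"]) (auto simp: inner_diff inner_commute)

lemma convex_lipschitz_const: "convex_lipschitz (\<lambda>x. a)"
  by (rule convex_lipschitzI[where \<xi>="\<lambda>_. 0" and K="0"]) auto

lemma convex_lipschitz_affine:
  assumes "convex_lipschitz \<psi>" "0 \<le> k"
  shows "convex_lipschitz (\<lambda>x. k * \<psi> x + d)"
proof -
  obtain \<xi> K where *: "\<psi> \<in> borel_measurable borel" "\<xi> \<in> borel_measurable borel"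
    "\<And>x. norm (\<xi> x) \<le> K" "\<And>x y. \<psi> y + \<xi> y \<bullet> (x - y) \<le> \<psi> x"
    using assms unfolding convex_lipschitz_def by blast
  show ?thesis
  proof (rule convex_lipschitzI[where \<xi>="\<lambda>x. k *\<^sub>R \<xi> x" and K="k * K"])
    show "k * \<psi> y + d + (k *\<^sub>R \<xi> y) \<bullet> (x - y) \<le> k * \<psi> x + d" for x y
      using mult_left_mono[OF *(4)[of y x] assms(2)] by (simp add: algebra_simps)
  qed (use * assms(2) in \<open>auto intro: mult_left_mono\<close>)
qed

lemma convex_lipschitz_max:
  assumes "convex_lipschitz \<phi>" "convex_lipschitz \<psi>"
  shows "convex_lipschitz (\<lambda>x. max (\<phi> x) (\<psi> x))"
proof -
  obtain \<xi> K where *: "\<phi> \<in> borel_measurable borel" "\<xi> \<in> borel_measurable borel"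
    "\<And>x. norm (\<xi> x) \<le> K" "\<And>x y. \<phi> y + \<xi> y \<bullet> (x - y) \<le> \<phi> x"
    using assms(1) unfolding convex_lipschitz_def by blast
  obtain \<zeta> L where **: "\<psi> \<in> borel_measurable borel" "\<zeta> \<in> borel_measurable borel"
    "\<And>x. norm (\<zeta> x) \<le> L" "\<And>x y. \<psi> y + \<zeta> y \<bullet> (x - y) \<le> \<psi> x"
    using assms(2) unfolding convex_lipschitz_def by blast
  note [measurable] = *(1,2) **(1,2)
  show ?thesis
  proof (rule convex_lipschitzI[where \<xi>="\<lambda>x. if \<psi> x \<le> \<phi> x then \<xi> x else \<zeta> x" and K="max K L"])
    show "norm (if \<psi> x \<le> \<phi> x then \<xi> x else \<zeta> x) \<le> max K L" for x
      using *(3)[of x] **(3)[of x] by auto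
    show "max (\<phi> y) (\<psi> y) + (if \<psi> y \<le> \<phi> y then \<xi> y else \<zeta> y) \<bullet> (x - y) \<le> max (\<phi> x) (\<psi> x)" for x y
      using *(4)[of y x] **(4)[of y x] by auto
  qed measurable
qed

text \<open>
  The sublevel sets \<open>{c \<le> 0}\<close> of these functions include the closed half-spaces, hence generate the Borel
  sets, and are stable under intersection since the class is closed under maxima. With
  \<open>c\<^sup>+ = max c 0\<close>, the indicator of \<open>{c \<le> 0}\<close> is the limit of
  \<open>max (1 - k c\<^sup>+) 0 = 1 - k c\<^sup>+ + max (k c\<^sup>+ - 1) 0\<close>, which is a combination of nonnegative functions of the class.
\<close>

lemma convex_lipschitz_determines_measure:
  fixes \<alpha> \<beta> :: "'a::euclidean_space measure"
  assumes \<alpha>: "\<alpha> \<in> finite_moment_measures 2" and \<beta>: "\<beta> \<in> finite_moment_measures 2"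
    and eq: "\<And>\<psi>. convex_lipschitz \<psi> \<Longrightarrow> (\<And>x. 0 \<le> \<psi> x) \<Longrightarrow> (\<integral>x. \<psi> x \<partial>\<alpha>) = (\<integral>x. \<psi> x \<partial>\<beta>)"
  shows "\<alpha> = \<beta>"
proof -
  have lim: "(\<lambda>k. 1 - (\<integral>x. real k * max (c x) 0 + 0 \<partial>\<mu>) + (\<integral>x. max (real k * max (c x) 0 + (-1)) 0 \<partial>\<mu>))
      \<longlonglongrightarrow> measure \<mu> {x. c x \<le> 0}"
    if c: "convex_lipschitz c" and \<mu>: "\<mu> \<in> finite_moment_measures 2" for c :: "'a \<Rightarrow> real" and \<mu>
  proof -
    have "prob_space \<mu>" and s: "sets \<mu> = sets borel" using \<mu> by (auto simp: finite_second_moment_iff)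
    interpret prob_space \<mu> by fact
    have sp: "space \<mu> = UNIV" using s by (metis sets_eq_imp_space_eq space_borel)
    have cm[measurable]: "c \<in> borel_measurable borel" using c by (simp add: convex_lipschitz_def)
    have cl: "integrable \<mu> \<psi>" if "convex_lipschitz \<psi>" for \<psi>
      using convex_lipschitz_has_subgradient[OF that] has_subgradient_integrable[OF _ \<mu>] by metis
    have i: "integrable \<mu> (\<lambda>x. real k * max (c x) 0 + 0)"
      "integrable \<mu> (\<lambda>x. max (real k * max (c x) 0 + (-1)) 0)" for k
      by (rule cl, intro convex_lipschitz_affine convex_lipschitz_max convex_lipschitz_const c of_nat_0_le_iff)+
    define f where "f k x = max (1 - real k * max (c x) 0) 0" for k :: nat and x
    have f: "f k x = 1 - (real k * max (c x) 0 + 0) + max (real k * max (c x) 0 + (-1)) 0" for k x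
      by (simp add: f_def max_def)
    have cs: "{x. c x \<le> 0} \<in> sets \<mu>" unfolding s by measurable
    have "(\<lambda>k. \<integral>x. f k x \<partial>\<mu>) \<longlonglongrightarrow> (\<integral>x. indicator {x. c x \<le> 0} x \<partial>\<mu>)"
    proof (rule integral_dominated_convergence[where w="\<lambda>_. 1"])
      show "f k \<in> borel_measurable \<mu>" for k
        unfolding borel_measurable_borel_sets[OF s] f_def by measurable
      show "(indicator {x. c x \<le> 0} :: 'a \<Rightarrow> real) \<in> borel_measurable \<mu>" using cs by simp
      show "AE x in \<mu>. (\<lambda>k. f k x) \<longlonglongrightarrow> indicator {x. c x \<le> 0} x"
      proof (rule AE_I2)
        fix x
        show "(\<lambda>k. f k x) \<longlonglongrightarrow> indicator {x. c x \<le> 0} x"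
        proof (cases "c x \<le> 0")
          case False
          obtain m :: nat where m: "1 / c x < real m" using reals_Archimedean2 by blast
          have "f k x = 0" if "m \<le> k" for k
          proof -
            have "1 \<le> real m * c x" using m False by (simp add: field_simps)
            also have "\<dots> \<le> real k * c x" using that False by (intro mult_right_mono) auto
            finally show ?thesis using False by (simp add: f_def)
          qed
          then show ?thesis
            using False by (intro tendsto_eventually) (auto simp: eventually_sequentially)
        qed (simp add: f_def max_def)
      qed
      show "AE x in \<mu>. norm (f k x) \<le> 1" for k by (intro AE_I2) (simp add: f_def)
    qed simp
    then show ?thesis using i cs prob_space by (simp add: f sp)
  qed
  define E where "E = {{x. c x \<le> 0} | c :: 'a \<Rightarrow> real. convex_lipschitz c}"
  have E_borel: "E \<subseteq> sets borel"
  proof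
    fix A assume "A \<in> E"
    then obtain c where c: "A = {x. c x \<le> 0}" and "convex_lipschitz c"
      by (auto simp: E_def)
    then have [measurable]: "c \<in> borel_measurable borel" by (simp add: convex_lipschitz_def)
    show "A \<in> sets borel" unfolding c by measurable
  qed
  have sE: "sets borel = sigma_sets UNIV E"
  proof
    have "sets (borel :: 'a measure) = sigma_sets UNIV ((\<lambda>(a, i). {x. x \<bullet> i \<le> a}) ` (UNIV \<times> Basis))"
      by (subst borel_eq_halfspace_le) simp
    also have "\<dots> \<subseteq> sigma_sets UNIV E"
    proof (rule sigma_sets_mono')
      show "(\<lambda>(a, i). {x. x \<bullet> i \<le> a}) ` (UNIV \<times> Basis) \<subseteq> E"
      proof clarify
        fix a and i :: 'a
        show "{x. x \<bullet> i \<le> a} \<in> E"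
          unfolding E_def
          by (intro CollectI exI[of _ "\<lambda>x. x \<bullet> i - a"] conjI convex_lipschitz_halfspace) simp
      qed
    qed
    finally show "sets (borel :: 'a measure) \<subseteq> sigma_sets UNIV E" .
    show "sigma_sets UNIV E \<subseteq> sets (borel :: 'a measure)"
      using sets.sigma_sets_subset[OF E_borel] by simp
  qed
  have "UNIV \<in> E" unfolding E_def using convex_lipschitz_const[of "0::real"] by auto
  show ?thesis
  proof (rule measure_eqI_generator_eq[where E=E and \<Omega>=UNIV and A="\<lambda>_. UNIV"])
    show "Int_stable E"
    proof (rule Int_stableI)
      fix A B assume "A \<in> E" "B \<in> E"
      then obtain c d where "A = {x. c x \<le> 0}" "B = {x. d x \<le> 0}" and cd: "convex_lipschitz c" "convex_lipschitz d"
        by (auto simp: E_def)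
      then have "A \<inter> B = {x. max (c x) (d x) \<le> 0}" by auto
      then show "A \<inter> B \<in> E"
        unfolding E_def
        by (intro CollectI exI[of _ "\<lambda>x. max (c x) (d x)"] conjI convex_lipschitz_max cd)
    qed
    have fin: "finite_measure \<alpha>" "finite_measure \<beta>"
      using \<alpha> \<beta> by (auto simp: finite_second_moment_iff prob_space.finite_measure)
    fix A assume "A \<in> E"
    then obtain c where A: "A = {x. c x \<le> 0}" and c: "convex_lipschitz c" by (auto simp: E_def)
    have 1: "convex_lipschitz (\<lambda>x. real k * max (c x) 0 + d)" for k d
      by (intro convex_lipschitz_affine convex_lipschitz_max convex_lipschitz_const c) simp
    have 2: "(\<integral>x. real k * max (c x) 0 + 0 \<partial>\<alpha>) = (\<integral>x. real k * max (c x) 0 + 0 \<partial>\<beta>)" for k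
      by (rule eq[OF 1]) simp
    have 3: "(\<integral>x. max (real k * max (c x) 0 + (-1)) 0 \<partial>\<alpha>) = (\<integral>x. max (real k * max (c x) 0 + (-1)) 0 \<partial>\<beta>)" for k
      by (rule eq[OF convex_lipschitz_max[OF 1 convex_lipschitz_const]]) simp
    have "measure \<alpha> A = measure \<beta> A"
      unfolding A using lim[OF c \<alpha>] lim[OF c \<beta>] unfolding 2 3 by (rule LIMSEQ_unique)
    then show "emeasure \<alpha> A = emeasure \<beta> A"
      using fin by (simp add: finite_measure.emeasure_eq_measure)
  next
    show "emeasure \<alpha> UNIV \<noteq> \<infinity>"
      using \<alpha> by (simp add: finite_second_moment_iff prob_space_def finite_measure.emeasure_finite)
  qed (use \<alpha> \<beta> sE \<open>UNIV \<in> E\<close> in \<open>auto simp: finite_second_moment_iff\<close>)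
qed

section \<open>Approximate gluing of couplings\<close>

text \<open>
  A point is sent to the index of the first element of a countable dense set within distance \<open>\<epsilon>/2\<close>.
\<close>

lemma countable_cells:
  assumes "\<epsilon> > 0"
  obtains q :: "'a::euclidean_space \<Rightarrow> nat"
  where "q \<in> borel \<rightarrow>\<^sub>M count_space UNIV" "\<And>x y. q x = q y \<Longrightarrow> norm (x - y) \<le> \<epsilon>"
proof -
  obtain D :: "'a set" where D: "countable D" "\<And>X. open X \<Longrightarrow> X \<noteq> {} \<Longrightarrow> \<exists>d\<in>D. d \<in> X"
    using countable_dense_setE by blast
  define d where "d = from_nat_into D"
  have ne: "D \<noteq> {}" using D(2)[of UNIV] by auto
  have ex: "\<exists>n. dist x (d n) < \<epsilon> / 2" for x
  proof -
    obtain p where "p \<in> D" "p \<in> ball x (\<epsilon> / 2)" using D(2)[of "ball x (\<epsilon> / 2)"] assms by auto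
    then show ?thesis using from_nat_into_surj[OF D(1)] by (metis d_def mem_ball)
  qed
  define q where "q x = (LEAST n. dist x (d n) < \<epsilon> / 2)" for x
  have "q \<in> borel \<rightarrow>\<^sub>M count_space UNIV" unfolding q_def by measurable
  moreover have "norm (x - y) \<le> \<epsilon>" if "q x = q y" for x y
  proof -
    have "dist x (d (q x)) < \<epsilon> / 2" "dist y (d (q y)) < \<epsilon> / 2"
      using LeastI_ex[OF ex[of x]] LeastI_ex[OF ex[of y]] by (simp_all only: q_def)
    then show ?thesis using dist_triangle_half_l[of x "d (q x)" \<epsilon> y] that by (simp add: dist_norm dist_commute)
  qed
  ultimately show thesis by (rule that)
qed

lemma coupling_sets:
  fixes \<mu> :: "'a::second_countable_topology measure"
  shows "\<gamma> \<in> couplings \<mu> \<nu> \<Longrightarrow> sets \<gamma> = sets (borel \<Otimes>\<^sub>M borel)"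
  unfolding borel_prod by (rule couplingsD(2))

text \<open>
  Partition the space into countably many small cells and couple the two pairs so that their second
  components fall into the same cell, independently given that cell. The density with respect to the
  product measure is \<open>1 / \<beta>(cell)\<close> if the two cells agree and \<open>0\<close> otherwise; integrating out either pair
  gives \<open>1\<close>, so the marginals are kept. The price for such an explicit formula is that the second
  components are only \<open>\<epsilon>\<close>-close rather than equal.
\<close>

lemma approximate_gluing:
  fixes \<alpha> \<beta> \<kappa> :: "'a::euclidean_space measure"
  assumes \<gamma>: "\<gamma> \<in> couplings \<alpha> \<beta>" and \<eta>: "\<eta> \<in> couplings \<kappa> \<beta>" and \<epsilon>: "\<epsilon> > 0"
  obtains \<Gamma> where "sets \<Gamma> = sets (\<gamma> \<Otimes>\<^sub>M \<eta>)"
    "\<And>f. f \<in> borel_measurable \<gamma> \<Longrightarrow> (\<integral>\<^sup>+w. f (fst w) \<partial>\<Gamma>) = (\<integral>\<^sup>+z. f z \<partial>\<gamma>)"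
    "\<And>f. f \<in> borel_measurable \<eta> \<Longrightarrow> (\<integral>\<^sup>+w. f (snd w) \<partial>\<Gamma>) = (\<integral>\<^sup>+z. f z \<partial>\<eta>)"
    "AE w in \<Gamma>. norm (snd (fst w) - snd (snd w)) \<le> \<epsilon>"
proof -
  obtain q :: "'a \<Rightarrow> nat" where q[measurable]: "q \<in> borel \<rightarrow>\<^sub>M count_space UNIV"
    and qd: "\<And>x y. q x = q y \<Longrightarrow> norm (x - y) \<le> \<epsilon>" using countable_cells[OF \<epsilon>] by blast
  interpret \<gamma>: prob_space \<gamma> using couplingsD[OF \<gamma>] by simp
  interpret \<eta>: prob_space \<eta> using couplingsD[OF \<eta>] by simp
  interpret \<beta>: prob_space \<beta> using couplingsD[OF \<eta>] by simp
  interpret P: pair_prob_space \<gamma> \<eta> ..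
  note s\<beta> = couplingsD(9)[OF \<gamma>]
  define N where "N k = measure \<beta> {x. q x = k}" for k
  have cell: "{x. q x = k} \<in> sets \<beta>" for k unfolding s\<beta> by measurable
  have cell_prob: "emeasure \<theta> {z. q (snd z) = k} = ennreal (N k)" if \<theta>: "\<theta> \<in> couplings \<mu> \<beta>" for \<theta> \<mu> k
  proof -
    have "emeasure \<beta> {x. q x = k} = emeasure \<theta> (snd -` {x. q x = k} \<inter> space \<theta>)"
      using coupling_measurable[OF \<theta>, of snd] cell[of k]
      by (subst couplingsD(5)[OF \<theta>, symmetric], subst emeasure_distr) (auto simp: s\<beta>)
    also have "snd -` {x. q x = k} \<inter> space \<theta> = {z. q (snd z) = k}"
      by (auto simp: couplingsD(3)[OF \<theta>])
    finally show ?thesis by (simp add: N_def \<beta>.emeasure_eq_measure)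
  qed
  have qm: "(\<lambda>z. q (snd z)) \<in> \<theta> \<rightarrow>\<^sub>M count_space UNIV" if \<theta>: "\<theta> \<in> couplings \<mu> \<beta>" for \<theta> \<mu>
    using measurable_comp[OF coupling_measurable[OF \<theta>, of snd] q] by (simp add: o_def)
  have N_pos: "AE z in \<theta>. N (q (snd z)) \<noteq> 0" if \<theta>: "\<theta> \<in> couplings \<mu> \<beta>" for \<theta> \<mu>
  proof -
    have "AE z in \<theta>. \<forall>k. N k = 0 \<longrightarrow> q (snd z) \<noteq> k"
    proof (subst AE_all_countable, intro allI)
      fix k
      show "AE z in \<theta>. N k = 0 \<longrightarrow> q (snd z) \<noteq> k"
      proof (cases "N k = 0")
        case True
        have "{z. q (snd z) = k} \<in> null_sets \<theta>"
          using cell_prob[OF \<theta>, of k] True measurable_sets[OF qm[OF \<theta>], of "{k}"]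
          by (auto simp: null_sets_def vimage_def couplingsD(3)[OF \<theta>])
        from AE_not_in[OF this] show ?thesis by simp
      qed simp
    qed
    then show ?thesis by eventually_elim auto
  qed
  define h where "h w = (if q (snd (fst w)) = q (snd (snd w)) then ennreal (1 / N (q (snd (fst w)))) else 0)"
    for w :: "('a \<times> 'a) \<times> ('a \<times> 'a)"
  \<comment> \<open>the density integrates to one over either pair; by symmetry of \<open>h\<close> one computation serves both\<close>
  have mixed: "(\<integral>\<^sup>+z. (if k = q (snd z) then ennreal (1 / N k) else 0) \<partial>\<theta>) = 1"
    if \<theta>: "\<theta> \<in> couplings \<mu> \<beta>" and k: "N k \<noteq> 0" for \<theta> \<mu> k
  proof -
    have "{z. q (snd z) = k} \<in> sets \<theta>"
      using measurable_sets[OF qm[OF \<theta>], of "{k}"] by (simp add: vimage_def couplingsD(3)[OF \<theta>])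
    then have "(\<integral>\<^sup>+z. ennreal (1 / N k) * indicator {z. q (snd z) = k} z \<partial>\<theta>) = ennreal (1 / N k) * ennreal (N k)"
      by (subst nn_integral_cmult_indicator) (simp_all add: cell_prob[OF \<theta>])
    also have "\<dots> = 1" using k by (subst ennreal_mult[symmetric]) (auto simp: N_def)
    finally have *: "(\<integral>\<^sup>+z. ennreal (1 / N k) * indicator {z. q (snd z) = k} z \<partial>\<theta>) = 1" .
    show ?thesis
      by (subst *[symmetric], rule nn_integral_cong) (auto split: split_indicator)
  qed
  note [measurable_cong] = coupling_sets[OF \<gamma>] coupling_sets[OF \<eta>]
  have [measurable]: "(\<lambda>k. ennreal (1 / N k)) \<in> borel_measurable (count_space UNIV)" by simp
  have "Measurable.pred (\<gamma> \<Otimes>\<^sub>M \<eta>) (\<lambda>w. \<exists>k. q (snd (fst w)) = k \<and> q (snd (snd w)) = k)"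
    by measurable
  then have [measurable]: "Measurable.pred (\<gamma> \<Otimes>\<^sub>M \<eta>) (\<lambda>w. q (snd (fst w)) = q (snd (snd w)))"
    by (simp add: eq_commute)
  have [measurable]: "(\<lambda>w. ennreal (1 / N (q (snd (fst w))))) \<in> borel_measurable (\<gamma> \<Otimes>\<^sub>M \<eta>)"
    by (rule measurable_compose[where g="\<lambda>k. ennreal (1 / N k)" and N="count_space UNIV"]) measurable
  have h[measurable]: "h \<in> borel_measurable (\<gamma> \<Otimes>\<^sub>M \<eta>)"
    unfolding h_def by (rule measurable_If) measurable
  define \<Gamma> where "\<Gamma> = density (\<gamma> \<Otimes>\<^sub>M \<eta>) h"
  have 1: "sets \<Gamma> = sets (\<gamma> \<Otimes>\<^sub>M \<eta>)" by (simp add: \<Gamma>_def)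
  have 2: "(\<integral>\<^sup>+w. f (fst w) \<partial>\<Gamma>) = (\<integral>\<^sup>+z. f z \<partial>\<gamma>)" if f[measurable]: "f \<in> borel_measurable \<gamma>" for f
  proof -
    have "(\<integral>\<^sup>+w. f (fst w) \<partial>\<Gamma>) = (\<integral>\<^sup>+w. h w * f (fst w) \<partial>(\<gamma> \<Otimes>\<^sub>M \<eta>))"
      unfolding \<Gamma>_def by (rule nn_integral_density) measurable
    also have "\<dots> = (\<integral>\<^sup>+z. \<integral>\<^sup>+z'. h (z, z') * f z \<partial>\<eta> \<partial>\<gamma>)"
      by (subst \<eta>.nn_integral_fst[symmetric]) (auto simp: case_prod_unfold)
    also have "\<dots> = (\<integral>\<^sup>+z. f z \<partial>\<gamma>)"
    proof (rule nn_integral_cong_AE)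
      show "AE z in \<gamma>. (\<integral>\<^sup>+z'. h (z, z') * f z \<partial>\<eta>) = f z"
        using N_pos[OF \<gamma>]
      proof eventually_elim
        case (elim z)
        have "(\<integral>\<^sup>+z'. h (z, z') * f z \<partial>\<eta>) = (\<integral>\<^sup>+z'. h (z, z') \<partial>\<eta>) * f z"
          by (intro nn_integral_multc measurable_compose_Pair1[OF _ h]) (simp add: couplingsD(3)[OF \<gamma>])
        also have "(\<integral>\<^sup>+z'. h (z, z') \<partial>\<eta>) = 1"
          using mixed[OF \<eta> elim] unfolding h_def fst_conv snd_conv .
        finally show ?case by simp
      qed
    qed
    finally show ?thesis .
  qed
  have 3: "(\<integral>\<^sup>+w. f (snd w) \<partial>\<Gamma>) = (\<integral>\<^sup>+z. f z \<partial>\<eta>)" if f[measurable]: "f \<in> borel_measurable \<eta>" for f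
  proof -
    have "(\<integral>\<^sup>+w. f (snd w) \<partial>\<Gamma>) = (\<integral>\<^sup>+w. h w * f (snd w) \<partial>(\<gamma> \<Otimes>\<^sub>M \<eta>))"
      unfolding \<Gamma>_def by (rule nn_integral_density) measurable
    also have "\<dots> = (\<integral>\<^sup>+z'. \<integral>\<^sup>+z. h (z, z') * f z' \<partial>\<gamma> \<partial>\<eta>)"
      by (subst P.nn_integral_snd[symmetric]) (auto simp: case_prod_unfold)
    also have "\<dots> = (\<integral>\<^sup>+z. f z \<partial>\<eta>)"
    proof (rule nn_integral_cong_AE)
      show "AE z' in \<eta>. (\<integral>\<^sup>+z. h (z, z') * f z' \<partial>\<gamma>) = f z'"
        using N_pos[OF \<eta>]
      proof eventually_elim
        case (elim z')
        have sym: "h (z, z') = (if q (snd z') = q (snd z) then ennreal (1 / N (q (snd z'))) else 0)" for z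
          by (auto simp: h_def)
        have "(\<integral>\<^sup>+z. h (z, z') * f z' \<partial>\<gamma>) = (\<integral>\<^sup>+z. h (z, z') \<partial>\<gamma>) * f z'"
          by (intro nn_integral_multc measurable_compose[OF measurable_Pair2' h]) (simp add: couplingsD(3)[OF \<eta>])
        also have "(\<integral>\<^sup>+z. h (z, z') \<partial>\<gamma>) = 1"
          using mixed[OF \<gamma> elim] by (simp add: sym)
        finally show ?case by simp
      qed
    qed
    finally show ?thesis .
  qed
  have 4: "AE w in \<Gamma>. norm (snd (fst w) - snd (snd w)) \<le> \<epsilon>"
    unfolding \<Gamma>_def AE_density[OF h] by (intro AE_I2) (auto simp: h_def intro: qd split: if_splits)
  show thesis using 1 2 3 4 by (rule that)
qed

lemma norm_sum3_sq_le:
  fixes x y z :: "'a::real_inner"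
  shows "(norm (x + y + z))\<^sup>2 \<le> 3 * ((norm x)\<^sup>2 + (norm y)\<^sup>2 + (norm z)\<^sup>2)"
proof -
  have "(norm (x + y + z))\<^sup>2 + (norm (x - y))\<^sup>2 + (norm (x - z))\<^sup>2 + (norm (y - z))\<^sup>2 = 3 * ((norm x)\<^sup>2 + (norm y)\<^sup>2 + (norm z)\<^sup>2)"
    by (simp add: power2_norm_eq_inner inner_add inner_diff inner_commute)
  then show ?thesis by (smt (verit) zero_le_power2)
qed

text \<open>
  From \<open>|u + v + w|\<^sup>2 \<le> 3 (|u|\<^sup>2 + |v|\<^sup>2 + |w|\<^sup>2)\<close> under the glued coupling, where \<open>v\<close> is the
  arbitrarily small gap of the approximate gluing. The factor \<open>3\<close> is harmless for limits.
\<close>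

lemma wasserstein_2_quasi_triangle:
  assumes \<alpha>: "\<alpha> \<in> finite_moment_measures 2" and \<beta>: "\<beta> \<in> finite_moment_measures 2"
    and \<kappa>: "\<kappa> \<in> finite_moment_measures 2"
  shows "(wasserstein 2 \<alpha> \<kappa>)\<^sup>2 \<le> 3 * ((wasserstein 2 \<alpha> \<beta>)\<^sup>2 + (wasserstein 2 \<kappa> \<beta>)\<^sup>2)"
proof (rule field_le_epsilon)
  fix e :: real assume e: "e > 0"
  obtain \<gamma> where \<gamma>: "\<gamma> \<in> couplings \<alpha> \<beta>" and c1: "sq_cost \<gamma> < (wasserstein 2 \<alpha> \<beta>)\<^sup>2 + e / 9"
    using wasserstein_2_sq_approx[OF \<alpha> \<beta>, of "e / 9"] e by auto
  obtain \<eta> where \<eta>: "\<eta> \<in> couplings \<kappa> \<beta>" and c2: "sq_cost \<eta> < (wasserstein 2 \<kappa> \<beta>)\<^sup>2 + e / 9"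
    using wasserstein_2_sq_approx[OF \<kappa> \<beta>, of "e / 9"] e by auto
  have "sqrt (e / 9) > 0" using e by simp
  from approximate_gluing[OF \<gamma> \<eta> this] obtain \<Gamma>
    where s: "sets \<Gamma> = sets (\<gamma> \<Otimes>\<^sub>M \<eta>)"
      and g1: "\<And>f. f \<in> borel_measurable \<gamma> \<Longrightarrow> (\<integral>\<^sup>+w. f (fst w) \<partial>\<Gamma>) = (\<integral>\<^sup>+z. f z \<partial>\<gamma>)"
      and g2: "\<And>f. f \<in> borel_measurable \<eta> \<Longrightarrow> (\<integral>\<^sup>+w. f (snd w) \<partial>\<Gamma>) = (\<integral>\<^sup>+z. f z \<partial>\<eta>)"
      and close: "AE w in \<Gamma>. norm (snd (fst w) - snd (snd w)) \<le> sqrt (e / 9)" by blast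
  interpret \<gamma>: prob_space \<gamma> using couplingsD[OF \<gamma>] by simp
  note [measurable_cong] = coupling_sets[OF \<gamma>] coupling_sets[OF \<eta>] s
  have T: "(\<lambda>w. (fst (fst w), fst (snd w))) \<in> borel_measurable \<Gamma>"
    unfolding borel_prod[symmetric] by measurable
  interpret \<Gamma>: prob_space \<Gamma>
  proof
    have "emeasure \<Gamma> (space \<Gamma>) = (\<integral>\<^sup>+w. 1 \<partial>\<Gamma>)" by simp
    also have "\<dots> = 1" using g1[of "\<lambda>_. 1"] by (simp add: \<gamma>.emeasure_space_1)
    finally show "emeasure \<Gamma> (space \<Gamma>) = 1" .
  qed
  define \<pi> where "\<pi> = distr \<Gamma> borel (\<lambda>w. (fst (fst w), fst (snd w)))"
  have f: "fst \<in> borel_measurable (borel :: ('a \<times> 'a) measure)" "snd \<in> borel_measurable (borel :: ('a \<times> 'a) measure)"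
    by (intro borel_measurable_continuous_onI continuous_on_fst continuous_on_snd continuous_on_id)+
  have marg1: "distr \<Gamma> borel (\<lambda>w. fst (fst w)) = \<alpha>"
  proof (rule measure_eqI)
    fix A assume "A \<in> sets (distr \<Gamma> borel (\<lambda>w. fst (fst w)))"
    then have [measurable]: "A \<in> sets borel" by simp
    have "emeasure (distr \<Gamma> borel (\<lambda>w. fst (fst w))) A = (\<integral>\<^sup>+w. indicator A (fst (fst w)) \<partial>\<Gamma>)"
      by (subst nn_integral_indicator[symmetric], simp, subst nn_integral_distr) auto
    also have "\<dots> = (\<integral>\<^sup>+z. indicator A (fst z) \<partial>\<gamma>)" by (rule g1) measurable
    also have "\<dots> = emeasure (distr \<gamma> borel fst) A"
      by (subst nn_integral_indicator[symmetric], simp, subst nn_integral_distr) auto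
    finally show "emeasure (distr \<Gamma> borel (\<lambda>w. fst (fst w))) A = emeasure \<alpha> A"
      by (simp add: couplingsD(4)[OF \<gamma>])
  qed (simp add: couplingsD[OF \<gamma>])
  have marg2: "distr \<Gamma> borel (\<lambda>w. fst (snd w)) = \<kappa>"
  proof (rule measure_eqI)
    fix A assume "A \<in> sets (distr \<Gamma> borel (\<lambda>w. fst (snd w)))"
    then have [measurable]: "A \<in> sets borel" by simp
    have "emeasure (distr \<Gamma> borel (\<lambda>w. fst (snd w))) A = (\<integral>\<^sup>+w. indicator A (fst (snd w)) \<partial>\<Gamma>)"
      by (subst nn_integral_indicator[symmetric], simp, subst nn_integral_distr) auto
    also have "\<dots> = (\<integral>\<^sup>+z. indicator A (fst z) \<partial>\<eta>)" by (rule g2) measurable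
    also have "\<dots> = emeasure (distr \<eta> borel fst) A"
      by (subst nn_integral_indicator[symmetric], simp, subst nn_integral_distr) auto
    finally show "emeasure (distr \<Gamma> borel (\<lambda>w. fst (snd w))) A = emeasure \<kappa> A"
      by (simp add: couplingsD(4)[OF \<eta>])
  qed (simp add: couplingsD[OF \<eta>])
  have \<pi>: "\<pi> \<in> couplings \<alpha> \<kappa>"
    using \<Gamma>.prob_space_distr[OF T] marg1 marg2 unfolding couplings_def prob_measures_def \<pi>_def
    by (simp add: distr_distr[OF f(1) T] distr_distr[OF f(2) T] o_def)
  have cost_nn: "(\<integral>\<^sup>+z. ennreal ((norm (fst z - snd z))\<^sup>2) \<partial>\<theta>) = ennreal (sq_cost \<theta>)"
    if "\<theta> \<in> couplings \<mu> \<nu>" "\<mu> \<in> finite_moment_measures 2" "\<nu> \<in> finite_moment_measures 2"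
    for \<theta> :: "('a \<times> 'a) measure" and \<mu> \<nu>
    unfolding sq_cost_def using coupling_sq_integrable[OF that] by (intro nn_integral_eq_integral) auto
  have dm: "(\<lambda>z::'a\<times>'a. ennreal ((norm (fst z - snd z))\<^sup>2)) \<in> borel_measurable borel"
    by (intro measurable_compose[OF _ measurable_ennreal] borel_measurable_continuous_onI continuous_intros)
  have three: "3 * (ennreal a + ennreal b + ennreal c) = ennreal (3 * (a + b + c))"
    if "0 \<le> a" "0 \<le> b" "0 \<le> c" for a b c
    using that ennreal_mult[of 3 "a + b + c"] by simp
  have "ennreal (sq_cost \<pi>) = (\<integral>\<^sup>+w. ennreal ((norm (fst (fst w) - fst (snd w)))\<^sup>2) \<partial>\<Gamma>)"
    unfolding cost_nn[OF \<pi> \<alpha> \<kappa>, symmetric] unfolding \<pi>_def by (subst nn_integral_distr[OF T]) (use dm in auto)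
  also have "\<dots> \<le> (\<integral>\<^sup>+w. 3 * (ennreal ((norm (fst (fst w) - snd (fst w)))\<^sup>2)
       + ennreal ((norm (fst (snd w) - snd (snd w)))\<^sup>2) + ennreal (e / 9)) \<partial>\<Gamma>)"
  proof (rule nn_integral_mono_AE)
    show "AE w in \<Gamma>. ennreal ((norm (fst (fst w) - fst (snd w)))\<^sup>2) \<le>
      3 * (ennreal ((norm (fst (fst w) - snd (fst w)))\<^sup>2) + ennreal ((norm (fst (snd w) - snd (snd w)))\<^sup>2) + ennreal (e / 9))"
      using close
    proof eventually_elim
      case (elim w)
      have "(norm (snd (fst w) - snd (snd w)))\<^sup>2 \<le> (sqrt (e / 9))\<^sup>2"
        using elim by (intro power_mono) auto
      then have "(norm (fst (fst w) - fst (snd w)))\<^sup>2 \<le> 3 * ((norm (fst (fst w) - snd (fst w)))\<^sup>2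
          + (norm (fst (snd w) - snd (snd w)))\<^sup>2 + e / 9)"
        using norm_sum3_sq_le[of "fst (fst w) - snd (fst w)" "snd (fst w) - snd (snd w)" "snd (snd w) - fst (snd w)"] e
        by (simp add: norm_minus_commute)
      from ennreal_leI[OF this] show ?case
        using e by (subst three) auto
    qed
  qed
  also have "\<dots> = 3 * ((\<integral>\<^sup>+w. ennreal ((norm (fst (fst w) - snd (fst w)))\<^sup>2) \<partial>\<Gamma>)
     + (\<integral>\<^sup>+w. ennreal ((norm (fst (snd w) - snd (snd w)))\<^sup>2) \<partial>\<Gamma>) + ennreal (e / 9))"
    by (simp add: nn_integral_cmult nn_integral_add \<Gamma>.emeasure_space_1)
  also have "(\<integral>\<^sup>+w. ennreal ((norm (fst (fst w) - snd (fst w)))\<^sup>2) \<partial>\<Gamma>) = ennreal (sq_cost \<gamma>)"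
    unfolding cost_nn[OF \<gamma> \<alpha> \<beta>, symmetric] by (rule g1) measurable
  also have "(\<integral>\<^sup>+w. ennreal ((norm (fst (snd w) - snd (snd w)))\<^sup>2) \<partial>\<Gamma>) = ennreal (sq_cost \<eta>)"
    unfolding cost_nn[OF \<eta> \<kappa> \<beta>, symmetric] by (rule g2) measurable
  also have "3 * (ennreal (sq_cost \<gamma>) + ennreal (sq_cost \<eta>) + ennreal (e / 9)) = ennreal (3 * (sq_cost \<gamma> + sq_cost \<eta> + e / 9))"
    using e sq_cost_nonneg by (subst three) auto
  finally have "sq_cost \<pi> \<le> 3 * (sq_cost \<gamma> + sq_cost \<eta> + e / 9)"
    using e sq_cost_nonneg[of \<gamma>] sq_cost_nonneg[of \<eta>] by (subst (asm) ennreal_le_iff) auto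
  then show "(wasserstein 2 \<alpha> \<kappa>)\<^sup>2 \<le> 3 * ((wasserstein 2 \<alpha> \<beta>)\<^sup>2 + (wasserstein 2 \<kappa> \<beta>)\<^sup>2) + e"
    using wasserstein_2_sq_le[OF \<alpha> \<kappa> \<pi>] c1 c2 by (simp add: algebra_simps)
qed

section \<open>Convergence\<close>

text \<open>
  From the pointwise bound \<open>u\<^sup>p \<le> \<eta>\<^sup>p + \<eta>\<^sup>p\<^sup>-\<^sup>2 u\<^sup>2\<close>, whose two terms cover \<open>u \<le> \<eta>\<close> and \<open>u > \<eta>\<close>.
\<close>

lemma coupling_powr_cost:
  fixes \<mu> \<nu> :: "'a::euclidean_space measure"
  assumes \<mu>: "\<mu> \<in> finite_moment_measures 2" and \<nu>: "\<nu> \<in> finite_moment_measures 2"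
    and \<gamma>: "\<gamma> \<in> couplings \<mu> \<nu>" and cost: "sq_cost \<gamma> \<le> \<eta>\<^sup>2" and \<eta>: "0 < \<eta>" and p: "1 \<le> p" "p \<le> 2"
  shows "integrable \<gamma> (\<lambda>z. norm (fst z - snd z) powr p)"
    and "(\<integral>z. norm (fst z - snd z) powr p \<partial>\<gamma>) \<le> 2 * \<eta> powr p"
proof -
  interpret prob_space \<gamma> by (rule couplingsD[OF \<gamma>])
  have powr_split: "u powr p = u powr (p - 2) * u\<^sup>2" if "0 \<le> u" for u
    using powr_add[of u "p - 2" 2] powr_two[OF that] by simp
  have pw: "u powr p \<le> \<eta> powr p + \<eta> powr (p - 2) * u\<^sup>2" if u: "0 \<le> u" for u
  proof (cases "u \<le> \<eta>")
    case True
    then have "u powr p \<le> \<eta> powr p" using u p by (intro powr_mono2) auto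
    then show ?thesis by (simp add: add_increasing2)
  next
    case False
    have "u powr p = u powr (p - 2) * u\<^sup>2" using u by (rule powr_split)
    also have "\<dots> \<le> \<eta> powr (p - 2) * u\<^sup>2"
      using False \<eta> p by (intro mult_right_mono powr_mono2') auto
    finally show ?thesis by (simp add: add_increasing)
  qed
  note i = coupling_sq_integrable[OF \<gamma> \<mu> \<nu>]
  have i2: "integrable \<gamma> (\<lambda>z. \<eta> powr p + \<eta> powr (p - 2) * (norm (fst z - snd z))\<^sup>2)" using i by simp
  show ip: "integrable \<gamma> (\<lambda>z. norm (fst z - snd z) powr p)"
  proof (rule Bochner_Integration.integrable_bound[OF i2])
    show "(\<lambda>z. norm (fst z - snd z) powr p) \<in> borel_measurable \<gamma>"
      by (rule coupling_measurable[OF \<gamma>]) measurable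
  qed (use pw in \<open>auto intro!: AE_I2\<close>)
  have "(\<integral>z. norm (fst z - snd z) powr p \<partial>\<gamma>) \<le> (\<integral>z. \<eta> powr p + \<eta> powr (p - 2) * (norm (fst z - snd z))\<^sup>2 \<partial>\<gamma>)"
    using ip i2 pw by (intro integral_mono) auto
  also have "\<dots> = \<eta> powr p + \<eta> powr (p - 2) * sq_cost \<gamma>"
    using i by (simp add: sq_cost_def prob_space)
  also have "\<dots> \<le> \<eta> powr p + \<eta> powr (p - 2) * \<eta>\<^sup>2"
    using cost by (intro add_left_mono mult_left_mono) auto
  also have "\<eta> powr (p - 2) * \<eta>\<^sup>2 = \<eta> powr p"
    using powr_split[of \<eta>] \<eta> by simp
  finally show "(\<integral>z. norm (fst z - snd z) powr p \<partial>\<gamma>) \<le> 2 * \<eta> powr p" by simp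
qed

lemma near_optimal_coupling:
  assumes "\<mu> \<in> finite_moment_measures 2" "\<nu> \<in> finite_moment_measures 2" "wasserstein 2 \<mu> \<nu> < \<eta>"
  obtains \<gamma> where "\<gamma> \<in> couplings \<mu> \<nu>" "sq_cost \<gamma> \<le> \<eta>\<^sup>2"
proof -
  have "(wasserstein 2 \<mu> \<nu>)\<^sup>2 < \<eta>\<^sup>2" using assms(3) wasserstein_nonneg by (intro power_strict_mono) auto
  then have "0 < \<eta>\<^sup>2 - (wasserstein 2 \<mu> \<nu>)\<^sup>2" by simp
  from wasserstein_2_sq_approx[OF assms(1,2) this] obtain \<gamma>
    where \<gamma>: "\<gamma> \<in> couplings \<mu> \<nu>" and cost: "sq_cost \<gamma> < (wasserstein 2 \<mu> \<nu>)\<^sup>2 + (\<eta>\<^sup>2 - (wasserstein 2 \<mu> \<nu>)\<^sup>2)" .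
  have "sq_cost \<gamma> \<le> \<eta>\<^sup>2" using cost by linarith
  with \<gamma> show thesis by (rule that)
qed

lemma wasserstein_le_wasserstein_2:
  fixes \<mu> \<nu> :: "'a::euclidean_space measure"
  assumes \<mu>: "\<mu> \<in> finite_moment_measures 2" and \<nu>: "\<nu> \<in> finite_moment_measures 2" and p: "1 \<le> p" "p \<le> 2"
  shows "wasserstein p \<mu> \<nu> \<le> 2 * wasserstein 2 \<mu> \<nu>"
proof -
  have "wasserstein p \<mu> \<nu> \<le> 2 * \<eta>" if \<eta>: "wasserstein 2 \<mu> \<nu> < \<eta>" for \<eta>
  proof -
    have \<eta>0: "0 < \<eta>" using wasserstein_nonneg \<eta> by (rule order_le_less_trans)
    obtain \<gamma> where \<gamma>: "\<gamma> \<in> couplings \<mu> \<nu>" "sq_cost \<gamma> \<le> \<eta>\<^sup>2" by (rule near_optimal_coupling[OF \<mu> \<nu> \<eta>])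
    let ?c = "\<lambda>\<gamma>. \<integral>z. norm (fst z - snd z) powr p \<partial>\<gamma>"
    have "(INF \<gamma>\<in>couplings \<mu> \<nu>. ?c \<gamma>) \<le> ?c \<gamma>"
      using \<gamma>(1) by (intro cINF_lower bdd_belowI[where m=0]) auto
    also have "\<dots> \<le> 2 * \<eta> powr p" using coupling_powr_cost(2)[OF \<mu> \<nu> \<gamma> \<eta>0 p] .
    also have "\<dots> \<le> 2 powr p * \<eta> powr p"
      using powr_mono[of 1 p 2] p by (intro mult_right_mono) auto
    also have "\<dots> = (2 * \<eta>) powr p" using \<eta>0 by (simp add: powr_mult)
    finally have "(INF \<gamma>\<in>couplings \<mu> \<nu>. ?c \<gamma>) \<le> (2 * \<eta>) powr p" .
    moreover have "0 \<le> (INF \<gamma>\<in>couplings \<mu> \<nu>. ?c \<gamma>)" using \<gamma>(1) by (intro cINF_greatest) auto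
    ultimately have "wasserstein p \<mu> \<nu> \<le> ((2 * \<eta>) powr p) powr (1 / p)"
      unfolding wasserstein_def using p by (intro powr_mono2) auto
    also have "\<dots> = 2 * \<eta>" using \<eta>0 p by (simp add: powr_powr)
    finally show ?thesis .
  qed
  note * = this
  show ?thesis
  proof (rule field_le_epsilon)
    fix e :: real assume "e > 0"
    then show "wasserstein p \<mu> \<nu> \<le> 2 * wasserstein 2 \<mu> \<nu> + e" using *[of "wasserstein 2 \<mu> \<nu> + e / 2"] by simp
  qed
qed

lemma convex_lipschitz_integral_tendsto:
  fixes \<alpha> :: "nat \<Rightarrow> 'a::euclidean_space measure"
  assumes \<psi>: "convex_lipschitz \<psi>" and \<alpha>: "\<And>k. \<alpha> k \<in> finite_moment_measures 2" and \<beta>: "\<beta> \<in> finite_moment_measures 2"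
    and lim: "(\<lambda>k. wasserstein 2 (\<alpha> k) \<beta>) \<longlonglongrightarrow> 0"
  shows "(\<lambda>k. \<integral>x. \<psi> x \<partial>\<alpha> k) \<longlonglongrightarrow> (\<integral>x. \<psi> x \<partial>\<beta>)"
proof -
  obtain K where K: "0 \<le> K" "\<And>x y. \<bar>\<psi> x - \<psi> y\<bar> \<le> K * norm (x - y)"
    using convex_lipschitz_imp_lipschitz[OF \<psi>] by metis
  obtain \<xi> L where sub: "has_subgradient \<psi> \<xi> L" by (rule convex_lipschitz_has_subgradient[OF \<psi>])
  have ps: "\<psi> \<in> borel_measurable borel" using \<psi> by (simp add: convex_lipschitz_def)
  show ?thesis
  proof (rule LIMSEQ_I)
    fix e :: real assume e: "0 < e"
    define \<eta> where "\<eta> = e / 2 / (2 * K + 1)"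
    have \<eta>: "0 < \<eta>" using e K by (simp add: \<eta>_def)
    have "2 * K * \<eta> < e"
    proof -
      have "2 * K * \<eta> \<le> (2 * K + 1) * \<eta>" using \<eta> by (simp add: algebra_simps)
      also have "\<dots> = e / 2" 
      proof -
        have "2 * K + 1 \<noteq> 0" using K(1) by linarith
        then show ?thesis unfolding \<eta>_def by (metis nonzero_mult_div_cancel_left times_divide_eq_right)
      qed
      also have "\<dots> < e" using e by simp
      finally show ?thesis .
    qed
    moreover have "\<bar>(\<integral>x. \<psi> x \<partial>\<alpha> k) - (\<integral>x. \<psi> x \<partial>\<beta>)\<bar> \<le> 2 * K * \<eta>" if k: "wasserstein 2 (\<alpha> k) \<beta> < \<eta>" for k
    proof -
      obtain \<gamma> where \<gamma>: "\<gamma> \<in> couplings (\<alpha> k) \<beta>" "sq_cost \<gamma> \<le> \<eta>\<^sup>2" by (rule near_optimal_coupling[OF \<alpha> \<beta> k])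
      note c = coupling_powr_cost[OF \<alpha> \<beta> \<gamma> \<eta>, of 1, simplified]
      note m = coupling_marginals[OF \<gamma>(1) ps] has_subgradient_integrable[OF sub \<alpha>[of k]] has_subgradient_integrable[OF sub \<beta>]
      have "\<bar>(\<integral>x. \<psi> x \<partial>\<alpha> k) - (\<integral>x. \<psi> x \<partial>\<beta>)\<bar> = \<bar>\<integral>z. \<psi> (fst z) - \<psi> (snd z) \<partial>\<gamma>\<bar>"
        using m by simp
      also have "\<dots> \<le> (\<integral>z. \<bar>\<psi> (fst z) - \<psi> (snd z)\<bar> \<partial>\<gamma>)" by (rule integral_abs_bound)
      also have "\<dots> \<le> (\<integral>z. K * norm (fst z - snd z) \<partial>\<gamma>)"
        using m c K(2) by (intro integral_mono) auto
      also have "\<dots> \<le> K * (2 * \<eta>)" using c K(1) \<eta> by (simp add: mult_left_mono)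
      finally show ?thesis by simp
    qed
    moreover have "\<forall>\<^sub>F k in sequentially. wasserstein 2 (\<alpha> k) \<beta> < \<eta>" using order_tendstoD(2)[OF lim \<eta>] .
    ultimately show "\<exists>no. \<forall>k\<ge>no. norm ((\<integral>x. \<psi> x \<partial>\<alpha> k) - (\<integral>x. \<psi> x \<partial>\<beta>)) < e"
      unfolding eventually_sequentially by (metis le_less_trans real_norm_def)
  qed
qed

lemma truncated_square_has_subgradient:
  "has_subgradient (\<lambda>x::'a::euclidean_space. max ((norm x)\<^sup>2 - R) 0) (\<lambda>x. if R < (norm x)\<^sup>2 then 2 *\<^sub>R x else 0) 2"
  unfolding has_subgradient_def
proof (intro conjI allI)
  fix x y :: 'a
  have "(norm y)\<^sup>2 + (2 *\<^sub>R y) \<bullet> (x - y) = (norm x)\<^sup>2 - (norm (x - y))\<^sup>2"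
    by (simp add: power2_norm_eq_inner inner_diff inner_commute)
  then have "(norm y)\<^sup>2 + (2 *\<^sub>R y) \<bullet> (x - y) \<le> (norm x)\<^sup>2" by simp
  then show "max ((norm y)\<^sup>2 - R) 0 + (if R < (norm y)\<^sup>2 then 2 *\<^sub>R y else 0) \<bullet> (x - y) \<le> max ((norm x)\<^sup>2 - R) 0"
    by (auto simp: max_def)
qed (auto, measurable)

lemma truncated_square_integral_tendsto:
  fixes \<mu> :: "'a::euclidean_space measure"
  assumes \<mu>: "\<mu> \<in> finite_moment_measures 2"
  shows "(\<lambda>n. \<integral>x. max ((norm x)\<^sup>2 - real n) 0 \<partial>\<mu>) \<longlonglongrightarrow> 0"
proof -
  have s: "sets \<mu> = sets borel" and i: "integrable \<mu> (\<lambda>x. (norm x)\<^sup>2)"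
    using \<mu> by (auto simp: finite_second_moment_iff)
  have "(\<lambda>n. \<integral>x. max ((norm x)\<^sup>2 - real n) 0 \<partial>\<mu>) \<longlonglongrightarrow> (\<integral>x. 0 \<partial>\<mu>)"
  proof (rule integral_dominated_convergence[OF _ _ i])
    show "AE x in \<mu>. (\<lambda>n. max ((norm x)\<^sup>2 - real n) 0) \<longlonglongrightarrow> 0"
    proof (rule AE_I2)
      fix x :: 'a
      obtain m :: nat where "(norm x)\<^sup>2 < real m" using reals_Archimedean2 by blast
      then have "max ((norm x)\<^sup>2 - real n) 0 = 0" if "m \<le> n" for n
        using that by (simp add: max_def)
      then show "(\<lambda>n. max ((norm x)\<^sup>2 - real n) 0) \<longlonglongrightarrow> 0"
        by (intro tendsto_eventually) (auto simp: eventually_sequentially)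
    qed
    show "(\<lambda>x. max ((norm x)\<^sup>2 - real n) 0) \<in> borel_measurable \<mu>" for n
      unfolding borel_measurable_borel_sets[OF s] by measurable
  qed (auto intro!: AE_I2)
  then show ?thesis by simp
qed

lemma not_tendsto_subsequence:
  fixes x :: "nat \<Rightarrow> 'a::metric_space"
  assumes "\<not> x \<longlonglongrightarrow> l"
  obtains e :: real and s :: "nat \<Rightarrow> nat" where "0 < e" "strict_mono s" "\<forall>k. e \<le> dist (x (s k)) l"
proof -
  obtain e where e: "0 < e" "\<not> (\<forall>\<^sub>F n in sequentially. dist (x n) l < e)"
    using assms by (auto simp: tendsto_iff)
  have inf: "infinite {n. \<not> dist (x n) l < e}"
    using e(2) unfolding cofinite_eq_sequentially[symmetric] eventually_cofinite .
  show thesis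
  proof (rule that[OF e(1) strict_mono_enumerate[OF inf]])
    show "\<forall>k. e \<le> dist (x (enumerate {n. \<not> dist (x n) l < e} k)) l"
      using enumerate_in_set[OF inf] by (simp add: not_less)
  qed
qed

theorem theorem2p3:
  fixes n :: nat
    and V :: "nat set"
    and E :: "nat \<Rightarrow> (nat \<times> nat) set"
    and w :: "nat \<Rightarrow> nat \<Rightarrow> nat \<Rightarrow> real"
    and \<delta> :: real
    and \<tau> :: "nat \<Rightarrow> nat"
    and \<mu> :: "nat \<Rightarrow> nat \<Rightarrow> (real ^ 'd) measure"
  assumes n_pos: "n \<ge> 1"
    and V_eq: "V = {1..n}"
    and A1_edges: "\<And>t. E t \<subseteq> V \<times> V"
    and A1_sym: "\<And>t. sym (E t)"
    and A1_loops: "\<And>t i. i \<in> V \<Longrightarrow> (i, i) \<in> E t"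
    and A2_pos: "\<And>t i j. i \<in> V \<Longrightarrow> j \<in> V \<Longrightarrow> (i, j) \<in> E t \<Longrightarrow> w i j t > 0"
    and A2_zero: "\<And>t i j. i \<in> V \<Longrightarrow> j \<in> V \<Longrightarrow> (i, j) \<notin> E t \<Longrightarrow> w i j t = 0"
    and A2_sum: "\<And>t i. i \<in> V \<Longrightarrow> (\<Sum>j\<in>neighbors V (E t) i. w i j t) = 1"
    and A3_range: "0 < \<delta>" "\<delta> < 1"
    and A3_lower: "\<And>t i j. i \<in> V \<Longrightarrow> j \<in> neighbors V (E t) i \<Longrightarrow> w i j t \<ge> \<delta>"
    and A4_start: "\<tau> 0 = 0"
    and A4_mono: "strict_mono \<tau>"
    and A4_gaps: "bdd_above (range (\<lambda>k. \<tau> (Suc k) - \<tau> k))"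
    and A4_connected: "\<And>k. connected_graph V (\<Union>t\<in>{\<tau> k..<\<tau> (Suc k)}. E t)"
    and init: "\<And>i. i \<in> V \<Longrightarrow> \<mu> i 0 \<in> ac_finite_moment_measures 2"
    and update: "\<And>i t. i \<in> V \<Longrightarrow>
      \<mu> i (Suc t) \<in> barycenters (neighbors V (E t) i) (\<lambda>j. \<mu> j t) (\<lambda>j. w i j t)"
  shows "(\<forall>i\<in>V. \<forall>j\<in>V. (\<lambda>t. wasserstein 2 (\<mu> i t) (\<mu> j t)) \<longlonglongrightarrow> 0) \<and>
    (\<exists>\<mu>' \<in> finite_moment_measures 2. \<forall>i\<in>V. \<forall>p\<in>{1..<2}.
       (\<lambda>t. wasserstein p (\<mu> i t) \<mu>') \<longlonglongrightarrow> 0)"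
proof -
  have V: "finite V" "V \<noteq> {}" using n_pos by (auto simp: V_eq)
  have fm: "\<mu> i t \<in> finite_moment_measures 2" if i: "i \<in> V" for i t
  proof (cases t)
    case 0 then show ?thesis using init[OF i] by (simp add: ac_finite_moment_measures_def)
  next
    case (Suc s) then show ?thesis using update[OF i, of s] by (simp add: barycenters_def is_arg_min_def)
  qed
  have step: "(\<integral>x. \<psi> x \<partial>\<mu> i (Suc t)) \<le> (\<Sum>j\<in>neighbors V (E t) i. w i j t * (\<integral>x. \<psi> x \<partial>\<mu> j t))"
    if \<psi>: "has_subgradient \<psi> \<xi> K" and i: "i \<in> V" for \<psi> \<xi> K i t
  proof (rule barycenter_convex_integral_le[OF \<psi> _ _ A2_sum[OF i] _ update[OF i]])
    show "finite (neighbors V (E t) i)" using V by (simp add: neighbors_def)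
    show "0 \<le> w i j t" if "j \<in> neighbors V (E t) i" for j using A3_lower[OF i that] A3_range by simp
    show "\<mu> j t \<in> finite_moment_measures 2" if "j \<in> neighbors V (E t) i" for j
      using that by (intro fm) (simp add: neighbors_def)
  qed
  have conv: "\<exists>l. \<forall>i\<in>V. (\<lambda>t. \<integral>x. \<psi> x \<partial>\<mu> i t) \<longlonglongrightarrow> l"
    and bound: "\<forall>i\<in>V. (\<integral>x. \<psi> x \<partial>\<mu> i t) \<le> Max ((\<lambda>i. \<integral>x. \<psi> x \<partial>\<mu> i 0) ` V)"
    if \<psi>: "has_subgradient \<psi> \<xi> K" and pos: "\<And>x. 0 \<le> \<psi> x" for \<psi> \<xi> K t
  proof -
    have nonneg: "0 \<le> (\<integral>x. \<psi> x \<partial>\<mu> i t)" for i t by (rule Bochner_Integration.integral_nonneg) (rule pos)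
    note c = consensus_of_averaging_inequality[OF V A1_edges A1_sym A1_loops A2_sum A3_range A3_lower
        A4_mono A4_gaps A4_connected nonneg step[OF \<psi>]]
    show "\<exists>l. \<forall>i\<in>V. (\<lambda>t. \<integral>x. \<psi> x \<partial>\<mu> i t) \<longlonglongrightarrow> l" by (rule c(1))
    show "\<forall>i\<in>V. (\<integral>x. \<psi> x \<partial>\<mu> i t) \<le> Max ((\<lambda>i. \<integral>x. \<psi> x \<partial>\<mu> i 0) ` V)" by (rule c(2))
  qed
  \<comment> \<open>the tails never exceed the largest initial tail\<close>
  have UI: "\<exists>R\<ge>0. \<forall>i\<in>V. \<forall>t. (\<integral>x. max ((norm x)\<^sup>2 - R) 0 \<partial>\<mu> i t) \<le> e" if e: "0 < e" for e
  proof -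
    have "\<forall>\<^sub>F m in sequentially. \<forall>i\<in>V. (\<integral>x. max ((norm x)\<^sup>2 - real m) 0 \<partial>\<mu> i 0) < e"
      using V(1) by (rule eventually_ball_finite) (use truncated_square_integral_tendsto[OF fm] order_tendstoD(2) e in blast)
    then obtain m where m: "\<And>i. i \<in> V \<Longrightarrow> (\<integral>x. max ((norm x)\<^sup>2 - real m) 0 \<partial>\<mu> i 0) < e"
      by (auto simp: eventually_sequentially)
    have "(\<integral>x. max ((norm x)\<^sup>2 - real m) 0 \<partial>\<mu> i t) \<le> e" if i: "i \<in> V" for i t
    proof -
      have "(\<integral>x. max ((norm x)\<^sup>2 - real m) 0 \<partial>\<mu> i t) \<le> Max ((\<lambda>i. \<integral>x. max ((norm x)\<^sup>2 - real m) 0 \<partial>\<mu> i 0) ` V)"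
        using bound[OF truncated_square_has_subgradient, of "real m" t] i by simp
      also have "\<dots> \<le> e" using V m by (auto intro: less_imp_le)
      finally show ?thesis .
    qed
    then show ?thesis by (intro exI[of _ "real m"]) auto
  qed
  have usi: "uniformly_square_integrable UNIV (\<lambda>k. \<mu> i (s k))" if "i \<in> V" for i and s :: "nat \<Rightarrow> nat"
    unfolding uniformly_square_integrable_def using UI that by metis
  obtain i\<^sub>0 where i\<^sub>0: "i\<^sub>0 \<in> V" using V by blast
  obtain r \<mu>' where r: "strict_mono r" and \<mu>': "\<mu>' \<in> finite_moment_measures 2"
    and lim: "(\<lambda>k. wasserstein 2 (\<mu> i\<^sub>0 (r k)) \<mu>') \<longlonglongrightarrow> 0"
    by (rule Wasserstein_compactness[OF fm[OF i\<^sub>0] usi[OF i\<^sub>0, of "\<lambda>k. k"]])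
  have main: "(\<lambda>t. wasserstein 2 (\<mu> i t) \<mu>') \<longlonglongrightarrow> 0" if i: "i \<in> V" for i
  proof (rule ccontr)
    assume "\<not> (\<lambda>t. wasserstein 2 (\<mu> i t) \<mu>') \<longlonglongrightarrow> 0"
    then obtain e :: real and s :: "nat \<Rightarrow> nat" where e: "0 < e" and s: "strict_mono s"
      and far: "\<forall>k. e \<le> dist (wasserstein 2 (\<mu> i (s k)) \<mu>') 0"
      by (rule not_tendsto_subsequence)
    obtain q \<beta> where q: "strict_mono q" and \<beta>: "\<beta> \<in> finite_moment_measures 2"
      and lim': "(\<lambda>k. wasserstein 2 (\<mu> i (s (q k))) \<beta>) \<longlonglongrightarrow> 0"
      by (rule Wasserstein_compactness[OF fm[OF i] usi[OF i, of s]])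
    \<comment> \<open>both limit points integrate every test function to the common limit over the network\<close>
    have "\<beta> = \<mu>'"
    proof (rule convex_lipschitz_determines_measure[OF \<beta> \<mu>'])
      fix \<psi> :: "real ^ 'd \<Rightarrow> real" assume \<psi>: "convex_lipschitz \<psi>" and pos: "\<And>x. 0 \<le> \<psi> x"
      obtain \<xi> K where sub: "has_subgradient \<psi> \<xi> K" by (rule convex_lipschitz_has_subgradient[OF \<psi>])
      obtain l where l: "\<And>i. i \<in> V \<Longrightarrow> (\<lambda>t. \<integral>x. \<psi> x \<partial>\<mu> i t) \<longlonglongrightarrow> l" using conv[OF sub pos] by blast
      have "strict_mono (s \<circ> q)" using s q by (rule strict_mono_o)
      then have "(\<lambda>k. \<integral>x. \<psi> x \<partial>\<mu> i (s (q k))) \<longlonglongrightarrow> l"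
        using LIMSEQ_subseq_LIMSEQ[OF l[OF i]] by (simp add: o_def)
      then have 1: "(\<integral>x. \<psi> x \<partial>\<beta>) = l"
        using convex_lipschitz_integral_tendsto[OF \<psi> fm[OF i] \<beta> lim'] LIMSEQ_unique by blast
      have "(\<lambda>k. \<integral>x. \<psi> x \<partial>\<mu> i\<^sub>0 (r k)) \<longlonglongrightarrow> l"
        using LIMSEQ_subseq_LIMSEQ[OF l[OF i\<^sub>0] r] by (simp add: o_def)
      then have "(\<integral>x. \<psi> x \<partial>\<mu>') = l"
        using convex_lipschitz_integral_tendsto[OF \<psi> fm[OF i\<^sub>0] \<mu>' lim] LIMSEQ_unique by blast
      with 1 show "(\<integral>x. \<psi> x \<partial>\<beta>) = (\<integral>x. \<psi> x \<partial>\<mu>')" by simp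
    qed
    then have "\<forall>\<^sub>F k in sequentially. wasserstein 2 (\<mu> i (s (q k))) \<mu>' < e"
      using order_tendstoD(2)[OF lim' e] by simp
    then obtain N where N: "wasserstein 2 (\<mu> i (s (q N))) \<mu>' < e"
      by (auto simp: eventually_sequentially)
    have "e \<le> dist (wasserstein 2 (\<mu> i (s (q N))) \<mu>') 0" using far by blast
    with N show False by (simp add: wasserstein_nonneg)
  qed
  have "(\<lambda>t. wasserstein 2 (\<mu> i t) (\<mu> j t)) \<longlonglongrightarrow> 0" if i: "i \<in> V" and j: "j \<in> V" for i j
  proof -
    have "(\<lambda>t. (wasserstein 2 (\<mu> i t) (\<mu> j t))\<^sup>2) \<longlonglongrightarrow> 0"
    proof (rule tendsto_sandwich[OF _ _ tendsto_const])
      show "\<forall>\<^sub>F t in sequentially. (wasserstein 2 (\<mu> i t) (\<mu> j t))\<^sup>2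
          \<le> 3 * ((wasserstein 2 (\<mu> i t) \<mu>')\<^sup>2 + (wasserstein 2 (\<mu> j t) \<mu>')\<^sup>2)"
        by (intro always_eventually allI wasserstein_2_quasi_triangle fm i j \<mu>')
      have "(\<lambda>t. 3 * ((wasserstein 2 (\<mu> i t) \<mu>')\<^sup>2 + (wasserstein 2 (\<mu> j t) \<mu>')\<^sup>2)) \<longlonglongrightarrow> 3 * (0\<^sup>2 + 0\<^sup>2)"
        by (intro tendsto_intros main i j)
      then show "(\<lambda>t. 3 * ((wasserstein 2 (\<mu> i t) \<mu>')\<^sup>2 + (wasserstein 2 (\<mu> j t) \<mu>')\<^sup>2)) \<longlonglongrightarrow> 0" by simp
    qed simp
    from tendsto_real_sqrt[OF this] show ?thesis by (simp add: wasserstein_nonneg)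
  qed
  moreover have "(\<lambda>t. wasserstein p (\<mu> i t) \<mu>') \<longlonglongrightarrow> 0" if i: "i \<in> V" and p: "p \<in> {1..<2}" for i p
  proof (rule tendsto_sandwich[OF _ _ tendsto_const])
    show "\<forall>\<^sub>F t in sequentially. 0 \<le> wasserstein p (\<mu> i t) \<mu>'" by (simp add: wasserstein_nonneg)
    show "\<forall>\<^sub>F t in sequentially. wasserstein p (\<mu> i t) \<mu>' \<le> 2 * wasserstein 2 (\<mu> i t) \<mu>'"
      using p by (intro always_eventually allI wasserstein_le_wasserstein_2 fm i \<mu>') auto
    show "(\<lambda>t. 2 * wasserstein 2 (\<mu> i t) \<mu>') \<longlonglongrightarrow> 0"
      using tendsto_mult[OF tendsto_const[of 2] main[OF i]] by simp
  qed
  ultimately show ?thesis using \<mu>' by blast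
qed

end
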